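(* Let $\mathbb{K}$ be a field of arbitrary characteristic, let $\ell\ge3$, and let $\mathcal{A}$ be an affine arrangement of hyperplanes in $V=\mathbb{K}^\ell$ with $\chi(\mathcal{A},t)=\sum_{i=0}^{\ell}(-1)^ib_it^{\ell-i}$. For a hyperplane $H$ in $V$ (in $\mathcal{A}$ or not), let $\chi(\mathcal{A}\cap H,t)=\sum_{i=0}^{\ell-1}(-1)^ic_it^{\ell-1-i}$, and put $h:=|\mathcal{A}\cap H|$. Then $$b_2\ge c_2+(b_1-h-1)h.$$ In particular, when $(b_1-1)^2-4b_2+4c_2\ge0$, there are no hyperplanes $L$ such that $$\frac{b_1-1-\sqrt{(b_1-1)^2-4b_2+4c_2}}{2}<|\mathcal{A}\cap L|<\frac{b_1-1+\sqrt{(b_1-1)^2-4b_2+4c_2}}{2}.$$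
   Context: An affine arrangement $\mathcal{A}$ of hyperplanes in $V=\mathbb{K}^\ell$ is a finite set of affine hyperplanes. $L(\mathcal{A})$ is the set of all nonempty intersections of subsets of $\mathcal{A}$ (including $V$, the empty intersection). Define $\mu(V)=1$ and $\mu(X)=-\sum_{Y\in L(\mathcal{A}),\,X\subsetneq Y\subset V}\mu(Y)$; the characteristic polynomial is $\chi(\mathcal{A},t)=\sum_{X\in L(\mathcal{A})}\mu(X)t^{\dim X}$ (so $b_1=|\mathcal{A}|$). For any hyperplane $H$ of $V$, whether or not it belongs to $\mathcal{A}$, $\mathcal{A}\cap H:=\{H\cap H'\mid H'\in\mathcal{A},\ H'\ne H,\ H\cap H'\ne\emptyset\}$, which is an affine arrangement of hyperplanes in the $(\ell-1)$-dimensional affine space $H$; $\chi(\mathcal{A}\cap H,t)$ is its characteristic polynomial. The set $\mathcal{A}\cap L$ for a hyperplane $L$ is defined in the same way.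
   Formalization: In the "In particular" clause, c_2 is the coefficient of χ(A∩L,t) for the excluded hyperplane L itself, not of a fixed other H; with c_2 from a different H the claim is false (x=0, y=0, x+y=1, x−y=3 in Q^3, H: z=0, L: x+2y=0). *)

theory Defs
  imports "HOL-Analysis.Analysis" "HOL-Computational_Algebra.Polynomial"
begin

definition aff_hyperplane :: "('k::field ^ 'n) set \<Rightarrow> bool" where
  "aff_hyperplane H \<longleftrightarrow>
     (\<exists>a c. a \<noteq> 0 \<and> H = {x. (\<Sum>i\<in>UNIV. a $ i * x $ i) = c})"

definition aff_arrangement :: "('k::field ^ 'n) set set \<Rightarrow> bool" where
  "aff_arrangement A \<longleftrightarrow> finite A \<and> (\<forall>H\<in>A. aff_hyperplane H)"

text \<open>
  The ambient affine space \<open>W\<close> is an explicit argument below, because \<open>\<A> \<inter> H\<close> is an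
  arrangement in \<open>H\<close>, which is only an affine subspace of \<open>'k ^ 'n\<close>.  For an arrangement in the
  whole space, \<open>W = UNIV\<close>.
\<close>

text \<open>The choice \<open>B = {}\<close> contributes \<open>W\<close> itself, since \<open>\<Inter>{} = UNIV\<close>.\<close>

definition flats :: "'p set \<Rightarrow> 'p set set \<Rightarrow> 'p set set" where
  "flats W A = {X. X \<noteq> {} \<and> (\<exists>B. B \<subseteq> A \<and> X = W \<inter> \<Inter>B)}"

lemma finite_flats: "finite A \<Longrightarrow> finite (flats W A)"
proof -
  assume "finite A"
  then have "finite ((\<lambda>B. W \<inter> \<Inter>B) ` Pow A)" by simp
  moreover have "flats W A \<subseteq> (\<lambda>B. W \<inter> \<Inter>B) ` Pow A" unfolding flats_def by auto
  ultimately show ?thesis by (rule finite_subset[rotated])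
qed

text \<open>
  The value for infinite \<open>A\<close> is junk, needed only to make the recursion terminate.  The condition
  \<open>Y \<subseteq> W\<close> is automatic for \<open>Y \<in> flats W A\<close>.
\<close>

function mu :: "'p set \<Rightarrow> 'p set set \<Rightarrow> 'p set \<Rightarrow> int" where
  "mu W A X =
     (if X = W then 1
      else if finite A then - (\<Sum>Y\<in>{Y \<in> flats W A. X \<subset> Y \<and> Y \<subseteq> W}. mu W A Y)
      else 0)"
  by pat_completeness auto
termination
proof (relation "Wellfounded.measure (\<lambda>(W, A, X). card {Y \<in> flats W A. X \<subset> Y})")
  fix W :: "'p set" and A :: "'p set set" and X Y :: "'p set"
  assume "finite A" and Y: "Y \<in> {Y \<in> flats W A. X \<subset> Y \<and> Y \<subseteq> W}"
  then have fin: "finite {Y \<in> flats W A. X \<subset> Y}"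
    by (simp add: finite_flats)
  have "{Z \<in> flats W A. Y \<subset> Z} \<subset> {Z \<in> flats W A. X \<subset> Z}"
    using Y by auto
  then have "card {Z \<in> flats W A. Y \<subset> Z} < card {Z \<in> flats W A. X \<subset> Z}"
    using fin by (rule psubset_card_mono[rotated])
  then show "((W, A, Y), (W, A, X)) \<in> Wellfounded.measure (\<lambda>(W, A, X). card {Y \<in> flats W A. X \<subset> Y})"
    by simp
qed auto

declare mu.simps [simp del]

lemma mu_top: "mu W A W = 1"
  by (simp add: mu.simps)

lemma mu_below:
  assumes "finite A" and "X \<noteq> W"
  shows "mu W A X = - (\<Sum>Y\<in>{Y \<in> flats W A. X \<subset> Y \<and> Y \<subseteq> W}. mu W A Y)"
  using assms by (subst mu.simps) simp

text \<open>
  For an affine subspace \<open>X\<close>, the set of differences is its direction, a linear subspace.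
  The library's \<open>aff_dim\<close> is restricted to real scalars.
\<close>

definition affine_dim :: "('k::field ^ 'n) set \<Rightarrow> nat" where
  "affine_dim X = vec.dim {x - y | x y. x \<in> X \<and> y \<in> X}"

definition char_polynomial :: "('k::field ^ 'n) set \<Rightarrow> ('k ^ 'n) set set \<Rightarrow> int poly" where
  "char_polynomial W A = (\<Sum>X\<in>flats W A. monom (mu W A X) (affine_dim X))"

definition restriction :: "'p set set \<Rightarrow> 'p set \<Rightarrow> 'p set set" where
  "restriction A H = {H \<inter> H' | H'. H' \<in> A \<and> H' \<noteq> H \<and> H \<inter> H' \<noteq> {}}"

end

theory Submission
  imports Defs "HOL-Computational_Algebra.Polynomial_Factorial"
begin

text \<open>
  Represent hyperplanes by their affine forms, add the hyperplane at infinity, and project the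
  resulting finite set \<open>E\<close> of projective points from the point \<open>w\<close> representing \<open>H\<close>.  The second
  Betti number is the sum of \<open>|B| - 1\<close> over the lines \<open>B\<close> spanned by \<open>E\<close>; grouping the lines not
  through \<open>w\<close> by the planes through \<open>w\<close> reduces everything to one plane, where dually we have \<open>N\<close>
  lines in the affine plane with \<open>r\<close> slopes, and must show
  \<open>(r - 1) (N - r + 1) \<le> \<Sum> (mult X - 1)\<close>, summed over the intersection points \<open>X\<close>.

  This planar inequality fails for general rank 3 matroids, so it needs algebra.  Count dimensions
  in the space of polynomial vector fields of degree less than \<open>N\<close> that are tangent to all lines.
  Imposing tangency to one more line \<open>l\<close> costs few conditions, because the normal component on \<open>l\<close>
  already vanishes to order \<open>m - 1\<close> at a point where \<open>m\<close> earlier lines meet \<open>l\<close>.  Conversely, the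
  leading part of a tangent field is constrained by its behaviour at the \<open>r\<close> points at infinity.
\<close>

text \<open>Lines through the point at infinity contribute \<open>b_1\<close> to the sum of
  \<open>|B| - 1\<close>, so the sum over all lines is \<open>b_1 + b_2\<close>. In the same way the
  configuration seen from \<open>w\<close> has \<open>h + 1\<close> points and gives
  \<open>h + c_2\<close>. If \<open>H\<close> is not in \<open>A\<close>, the projective inequality
  thus reads \<open>c_2 + h + (h + 1) (b_1 - h) \<le> b_2 + b_1\<close>, that is
  \<open>c_2 + h (b_1 - h) \<le> b_2\<close>. The summand -1 in the theorem pays for the case that
  \<open>H\<close> belongs to \<open>A\<close> and has to be deleted.

  In the plane, pairs of degree less than \<open>N\<close> form a space of dimension
  \<open>N (N + 1)\<close>. Let line \<open>k\<close> meet the earlier lines in \<open>p\<close>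
  points off \<open>H\<close>. Tangency to the earlier lines forces \<open>k - p\<close> zeros on
  the normal component along line \<open>k\<close>, so tangency to line \<open>k\<close> costs at
  most \<open>N - (k - p)\<close> conditions, and the sum of all \<open>p\<close> is the right-hand
  side of the planar inequality. The fields tangent to all lines are bounded by peeling off leading
  parts degree by degree. Together the two estimates are sharp enough for the quadratic terms to
  cancel exactly.\<close>

section \<open>Linear systems and multiplicities of roots\<close>

text \<open>Gaussian elimination, one pivot per equation. The index set \<open>J\<close> is
  arbitrary because the equations will later be indexed by functionals.\<close>

lemma homogeneous_system_nontrivial_solution:
  fixes M :: "'j \<Rightarrow> 'i \<Rightarrow> 'f::field"
  assumes "finite J" "finite I" "card J < card I"
  shows "\<exists>x. (\<exists>i\<in>I. x i \<noteq> 0) \<and> (\<forall>j\<in>J. (\<Sum>i\<in>I. M j i * x i) = 0)"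
  using assms
proof (induction J arbitrary: I M rule: finite_induct)
  case empty
  then have "I \<noteq> {}" by auto
  then show ?case by (intro exI[of _ "\<lambda>_. 1"]) auto
next
  case (insert j0 J)
  show ?case
  proof (cases "\<forall>i\<in>I. M j0 i = 0")
    case True
    have "card J < card I" using insert by simp
    from insert.IH[OF insert.prems(1) this, of M] True show ?thesis by auto
  next
    case False
    then obtain i0 where i0: "i0 \<in> I" "M j0 i0 \<noteq> 0" by auto
    define I' where "I' = I - {i0}"
    have I': "finite I'" "card J < card I'" "I = insert i0 I'" "i0 \<notin> I'"
      using insert i0 by (auto simp: I'_def)
    obtain x where x: "\<exists>i\<in>I'. x i \<noteq> 0"
      "\<forall>j\<in>J. (\<Sum>i\<in>I'. (M j i - M j i0 * M j0 i / M j0 i0) * x i) = 0"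
      using insert.IH[OF I'(1,2), of "\<lambda>j i. M j i - M j i0 * M j0 i / M j0 i0"] by auto
    define t where "t = - (\<Sum>i\<in>I'. M j0 i * x i) / M j0 i0"
    define y where "y = x(i0 := t)"
    have split: "(\<Sum>i\<in>I. M j i * y i) = M j i0 * t + (\<Sum>i\<in>I'. M j i * x i)" for j
    proof -
      have "(\<Sum>i\<in>I'. M j i * y i) = (\<Sum>i\<in>I'. M j i * x i)"
        by (rule sum.cong) (use I' in \<open>auto simp: y_def\<close>)
      then show ?thesis using I' by (simp add: y_def)
    qed
    have "(\<Sum>i\<in>I. M j i * y i) = 0" if "j \<in> insert j0 J" for j
    proof (cases "j = j0")
      case True
      then show ?thesis unfolding split using i0 by (simp add: t_def)
    next
      case False
      then have "j \<in> J" using that by simp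
      then have "0 = (\<Sum>i\<in>I'. M j i * x i) - (\<Sum>i\<in>I'. M j i0 / M j0 i0 * (M j0 i * x i))"
        using x(2) by (simp add: sum_subtractf left_diff_distrib mult.assoc)
      also have "\<dots> = (\<Sum>i\<in>I'. M j i * x i) - M j i0 / M j0 i0 * (\<Sum>i\<in>I'. M j0 i * x i)"
        by (simp add: sum_distrib_left)
      also have "\<dots> = (\<Sum>i\<in>I. M j i * y i)"
        unfolding split by (simp add: t_def)
      finally show ?thesis by simp
    qed
    moreover have "\<exists>i\<in>I. y i \<noteq> 0"
      using x(1) I' by (auto simp: y_def)
    ultimately show ?thesis by blast
  qed
qed

lemma sum_multiplicity_le_degree:
  fixes p :: "'f::idom poly"
  assumes "p \<noteq> 0" "finite S" "\<And>z. z \<in> S \<Longrightarrow> [:-z, 1:] ^ n z dvd p"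
  shows "(\<Sum>z\<in>S. n z) \<le> degree p"
proof -
  have "(\<Sum>z\<in>S. n z) \<le> (\<Sum>z\<in>S. count (proots p) z)"
    using assms by (intro sum_mono) (auto simp: order_divides)
  also have "\<dots> = (\<Sum>z\<in>S \<inter> set_mset (proots p). count (proots p) z)"
    using assms(2) by (intro sum.mono_neutral_right) (auto simp: count_eq_zero_iff simp del: count_proots set_count_proots)
  also have "\<dots> \<le> (\<Sum>z\<in>set_mset (proots p). count (proots p) z)"
    by (intro sum_mono2) auto
  also have "\<dots> = size (proots p)" by (simp add: size_multiset_overloaded_eq)
  also have "\<dots> \<le> degree p" by (rule size_proots_le)
  finally show ?thesis .
qed

text \<open>A nonzero polynomial of degree less than \<open>e\<close> cannot have \<open>e\<close>
  roots with multiplicity. The degree bound is phrased by coefficients so that a known degree bound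
  can be combined with vanishing conditions on the top coefficients.\<close>

lemma poly_eq_0_if_multiplicities:
  fixes p :: "'f::idom poly"
  assumes "finite S" "\<And>z. z \<in> S \<Longrightarrow> [:-z, 1:] ^ n z dvd p"
    and "e \<le> (\<Sum>z\<in>S. n z)" "\<And>i. e \<le> i \<Longrightarrow> coeff p i = 0"
  shows "p = 0"
proof (rule ccontr)
  assume p: "p \<noteq> 0"
  then have "degree p < e" using assms(4)[of "degree p"] by (metis leading_coeff_0_iff not_le)
  with sum_multiplicity_le_degree[OF p assms(1,2)] assms(3) show False by simp
qed

text \<open>Used over the domain of polynomials in \<open>z\<close>: a root \<open>[:a, c:]\<close>
  of \<open>F\<close> is then a line \<open>s = a + c * z\<close> on which \<open>F\<close>
  vanishes, and the linear factor is the equation of that line.\<close>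

lemma prod_linear_factors_dvd:
  fixes F :: "'f::idom poly"
  assumes "finite R" "\<And>\<rho>. \<rho> \<in> R \<Longrightarrow> poly F \<rho> = 0"
  shows "(\<Prod>\<rho>\<in>R. [:-\<rho>, 1:]) dvd F"
  using assms
proof (induction R arbitrary: F rule: finite_induct)
  case (insert \<rho> R)
  then obtain G where G: "F = [:-\<rho>, 1:] * G"
    by (metis dvd_def insertI1 poly_eq_0_iff_dvd)
  have "poly G \<sigma> = 0" if "\<sigma> \<in> R" for \<sigma>
    using insert.prems[of \<sigma>] that insert.hyps G by auto
  then have "(\<Prod>\<rho>\<in>R. [:-\<rho>, 1:]) dvd G" by (rule insert.IH)
  then show ?case using insert.hyps G by (simp add: mult_dvd_mono del: mult_pCons_left)
qed simp

section \<open>Line arrangements in the plane\<close>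

text \<open>Bivariate polynomials are polynomials in \<open>s\<close> over polynomials in \<open>z\<close>; the degree is the total one.\<close>

definition deg_lt :: "nat \<Rightarrow> 'f::field poly poly \<Rightarrow> bool" where
  "deg_lt D F \<longleftrightarrow> (\<forall>i j. coeff (coeff F i) j \<noteq> 0 \<longrightarrow> i + j < D)"

lemma deg_lt_diff: "deg_lt D F \<Longrightarrow> deg_lt D G \<Longrightarrow> deg_lt D (F - G)"
  unfolding deg_lt_def by (metis coeff_diff diff_zero)

lemma deg_lt_smult: "deg_lt D F \<Longrightarrow> deg_lt D (smult [:t:] F)"
  unfolding deg_lt_def by auto

text \<open>Substituting a polynomial of degree at most 1 in \<open>z\<close> for \<open>s\<close>
  does not raise the total degree.\<close>

lemma coeff_poly_line:
  assumes F: "deg_lt D F" and "D \<le> n"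
  shows "coeff (poly F [:a, c:]) n = 0"
proof -
  have "coeff (coeff F i * [:a, c:] ^ i) n = 0" for i
  proof (cases "coeff F i = 0")
    case False
    then have "i + degree (coeff F i) < D" using F unfolding deg_lt_def by simp
    moreover have "degree ([:a, c:] ^ i) \<le> i"
      using degree_power_le[of "[:a, c:]" i] by (auto split: if_splits)
    then have "degree (coeff F i * [:a, c:] ^ i) \<le> degree (coeff F i) + i"
      by (meson add_left_mono degree_mult_le le_trans)
    ultimately show ?thesis using assms(2) by (intro coeff_eq_0) simp
  qed simp
  then show ?thesis unfolding poly_altdef by (simp add: coeff_sum)
qed

text \<open>Scalars act through constant polynomials \<open>[:t:]\<close>, because
  \<open>smult\<close> on \<open>'f poly poly\<close> takes its scalars from
  \<open>'f poly\<close>.\<close>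

definition functional :: "('f::field poly poly \<Rightarrow> 'f poly poly \<Rightarrow> 'f) \<Rightarrow> bool" where
  "functional \<phi> \<longleftrightarrow> (\<forall>P Q P' Q'. \<phi> (P + P') (Q + Q') = \<phi> P Q + \<phi> P' Q')
     \<and> (\<forall>t P Q. \<phi> (smult [:t:] P) (smult [:t:] Q) = t * \<phi> P Q)"

text \<open>A way of saying that the space \<open>S\<close> of pairs has dimension at most \<open>n\<close>.\<close>

definition detect :: "('f::field poly poly \<Rightarrow> 'f poly poly \<Rightarrow> bool) \<Rightarrow> nat \<Rightarrow> bool" where
  "detect S n \<longleftrightarrow> (\<exists>\<Phi>. finite \<Phi> \<and> card \<Phi> \<le> n \<and> (\<forall>\<phi>\<in>\<Phi>. functional \<phi>)
     \<and> (\<forall>P Q. S P Q \<longrightarrow> (\<forall>\<phi>\<in>\<Phi>. \<phi> P Q = 0) \<longrightarrow> P = 0 \<and> Q = 0))"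

definition pfunctional :: "('f::field poly poly \<Rightarrow> 'f poly poly \<Rightarrow> 'f poly) \<Rightarrow> bool" where
  "pfunctional f \<longleftrightarrow> (\<forall>P Q P' Q'. f (P + P') (Q + Q') = f P Q + f P' Q')
     \<and> (\<forall>t P Q. f (smult [:t:] P) (smult [:t:] Q) = smult t (f P Q))"

text \<open>Rank-nullity as an inequality: the given functionals handle the kernel of
  \<open>f\<close> on \<open>S\<close>, and the coefficients in \<open>I\<close> decide whether the
  image under \<open>f\<close> vanishes.\<close>

lemma detect_extend:
  assumes "detect (\<lambda>P Q. S P Q \<and> f P Q = 0) n" "pfunctional f" "finite I"
    and "\<And>P Q. S P Q \<Longrightarrow> (\<And>i. i \<in> I \<Longrightarrow> coeff (f P Q) i = 0) \<Longrightarrow> f P Q = 0"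
  shows "detect S (n + card I)"
proof -
  obtain \<Phi> where \<Phi>: "finite \<Phi>" "card \<Phi> \<le> n" "\<forall>\<phi>\<in>\<Phi>. functional \<phi>"
    "\<And>P Q. S P Q \<Longrightarrow> f P Q = 0 \<Longrightarrow> \<forall>\<phi>\<in>\<Phi>. \<phi> P Q = 0 \<Longrightarrow> P = 0 \<and> Q = 0"
    using assms(1) unfolding detect_def by blast
  define \<Psi> where "\<Psi> = (\<lambda>i P Q. coeff (f P Q) i) ` I"
  have "card (\<Phi> \<union> \<Psi>) \<le> n + card I"
    using \<Phi>(2) card_Un_le[of \<Phi> \<Psi>] card_image_le[OF assms(3), of "\<lambda>i P Q. coeff (f P Q) i"]
    unfolding \<Psi>_def by linarith
  moreover have "\<forall>\<phi>\<in>\<Phi> \<union> \<Psi>. functional \<phi>"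
    using \<Phi>(3) assms(2) by (auto simp: \<Psi>_def functional_def pfunctional_def)
  moreover have "P = 0 \<and> Q = 0" if S: "S P Q" and zero: "\<forall>\<phi>\<in>\<Phi> \<union> \<Psi>. \<phi> P Q = 0" for P Q
  proof (rule \<Phi>(4)[OF S])
    have "coeff (f P Q) i = 0" if "i \<in> I" for i
      using bspec[OF zero, of "\<lambda>P Q. coeff (f P Q) i"] that unfolding \<Psi>_def by blast
    then show "f P Q = 0" by (rule assms(4)[OF S])
  qed (use zero in blast)
  ultimately show ?thesis
    unfolding detect_def using \<Phi>(1) assms(3) by (intro exI[of _ "\<Phi> \<union> \<Psi>"]) (auto simp: \<Psi>_def)
qed

lemma functional_zero: "functional \<phi> \<Longrightarrow> \<phi> 0 0 = 0"
  unfolding functional_def by (metis add_0 add_cancel_left_left)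

lemma functional_sum:
  assumes "functional \<phi>" "finite I"
  shows "\<phi> (\<Sum>i\<in>I. smult [:x i:] (P i)) (\<Sum>i\<in>I. smult [:x i:] (Q i)) = (\<Sum>i\<in>I. \<phi> (P i) (Q i) * x i)"
  using assms(2)
proof (induction I rule: finite_induct)
  case (insert i I)
  then show ?case using assms(1) by (simp add: functional_def mult.commute)
qed (use assms(1) in \<open>simp add: functional_zero\<close>)

lemma card_triangle: "card {(i::nat, j::nat). i + j < D} * 2 = D * (D + 1)"
proof -
  have "{(i, j). i + j < D} = (SIGMA i:{..<D}. {..<D - i})" by auto
  then have "card {(i, j). i + j < D} = (\<Sum>i<D. D - i)" by simp
  also have "(\<Sum>i<D. D - i) * 2 = D * (D + 1)"
  proof (induction D)
    case (Suc D)
    have "(\<Sum>i<Suc D. Suc D - i) = Suc D + (\<Sum>i<D. D - i)"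
      by (simp add: sum.lessThan_Suc_shift del: sum.lessThan_Suc)
    then show ?case using Suc.IH by (simp add: algebra_simps)
  qed simp
  finally show ?thesis .
qed

lemma coeff_sum_monom:
  assumes "finite I" "(m, l) \<in> I"
  shows "coeff (coeff (\<Sum>i\<in>I. smult [:x i:] (monom (monom (1::'f::field) (snd i)) (fst i))) m) l = x (m, l)"
proof -
  have "coeff (coeff (\<Sum>i\<in>I. smult [:x i:] (monom (monom (1::'f::field) (snd i)) (fst i))) m) l
      = (\<Sum>i\<in>I. if i = (m, l) then x i else 0)"
    unfolding coeff_sum by (intro sum.cong refl) (auto simp: prod_eq_iff)
  also have "\<dots> = x (m, l)" using assms by simp
  finally show ?thesis .
qed

text \<open>The monomials give \<open>D * (D + 1) / 2\<close> dimensions for each component, so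
  fewer than \<open>D * (D + 1)\<close> functionals have a common nonzero zero. The boolean index
  tells in which component a monomial sits.\<close>

lemma detect_all_lower_bound:
  assumes "detect (\<lambda>P Q :: 'f::field poly poly. deg_lt D P \<and> deg_lt D Q) n"
  shows "D * (D + 1) \<le> n"
proof (rule ccontr)
  assume less: "\<not> ?thesis"
  obtain \<Phi> :: "('f poly poly \<Rightarrow> 'f poly poly \<Rightarrow> 'f) set" where \<Phi>: "finite \<Phi>" "card \<Phi> \<le> n" "\<forall>\<phi>\<in>\<Phi>. functional \<phi>"
    "\<And>P Q. deg_lt D P \<Longrightarrow> deg_lt D Q \<Longrightarrow> \<forall>\<phi>\<in>\<Phi>. \<phi> P Q = 0 \<Longrightarrow> P = 0 \<and> Q = 0"
    using assms unfolding detect_def by blast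
  define T where "T = {(i::nat, j::nat). i + j < D}"
  define mon :: "nat \<times> nat \<Rightarrow> 'f poly poly" where "mon i = monom (monom 1 (snd i)) (fst i)" for i
  have "T \<subseteq> {..<D} \<times> {..<D}" by (auto simp: T_def)
  then have finT: "finite T" by (rule finite_subset) simp
  define I where "I = (UNIV :: bool set) \<times> T"
  have finI: "finite I" unfolding I_def using finT by simp
  have cardI: "card I = D * (D + 1)" unfolding I_def T_def card_cartesian_product
    using card_triangle[of D] by simp
  define p where "p i = (if fst i then mon (snd i) else 0)" for i :: "bool \<times> nat \<times> nat"
  define q where "q i = (if fst i then 0 else mon (snd i))" for i :: "bool \<times> nat \<times> nat"
  obtain x where x: "\<exists>i\<in>I. x i \<noteq> 0" "\<forall>\<phi>\<in>\<Phi>. (\<Sum>i\<in>I. \<phi> (p i) (q i) * x i) = 0"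
    using homogeneous_system_nontrivial_solution[OF \<Phi>(1) finI, of "\<lambda>\<phi> i. \<phi> (p i) (q i)"]
      less \<Phi>(2) cardI by auto
  define P where "P = (\<Sum>i\<in>I. smult [:x i:] (p i))"
  define Q where "Q = (\<Sum>i\<in>I. smult [:x i:] (q i))"
  have PT: "P = (\<Sum>i\<in>T. smult [:x (True, i):] (mon i))"
    unfolding P_def I_def sum.cartesian_product[symmetric, of "\<lambda>b i. smult [:x (b, i):] (p (b, i))", simplified]
    by (simp add: UNIV_bool p_def)
  have QT: "Q = (\<Sum>i\<in>T. smult [:x (False, i):] (mon i))"
    unfolding Q_def I_def sum.cartesian_product[symmetric, of "\<lambda>b i. smult [:x (b, i):] (q (b, i))", simplified]
    by (simp add: UNIV_bool q_def)
  have deg: "deg_lt D (\<Sum>i\<in>T. smult [:y i:] (mon i))" for y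
    unfolding deg_lt_def
  proof (intro allI impI)
    fix i j assume "coeff (coeff (\<Sum>i\<in>T. smult [:y i:] (mon i)) i) j \<noteq> 0"
    then obtain k where "k \<in> T" "coeff (coeff (smult [:y k:] (mon k)) i) j \<noteq> 0"
      unfolding coeff_sum by (meson sum.not_neutral_contains_not_neutral)
    then show "i + j < D" by (auto simp: mon_def T_def split: if_splits)
  qed
  have "P = 0 \<and> Q = 0"
  proof (rule \<Phi>(4))
    show "\<forall>\<phi>\<in>\<Phi>. \<phi> P Q = 0"
      using x(2) \<Phi>(3) finI by (auto simp: P_def Q_def functional_sum)
  qed (use deg in \<open>auto simp: PT QT\<close>)
  moreover obtain b m l where "(b, m, l) \<in> I" "x (b, m, l) \<noteq> 0" using x(1) by auto
  then have "(m, l) \<in> T" "x (b, m, l) \<noteq> 0" by (auto simp: I_def)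
  then have "if b then coeff (coeff P m) l \<noteq> 0 else coeff (coeff Q m) l \<noteq> 0"
    using coeff_sum_monom[OF finT, of m l "\<lambda>i. x (b, i)"] by (cases b) (simp_all add: PT QT mon_def)
  ultimately show False by (simp split: if_splits)
qed

text \<open>
  The projective plane in a chart where \<open>H\<close> is the line \<open>z = 0\<close> and line number \<open>j\<close> is
  \<open>s = a j + c j * z\<close>.  Lines with equal \<open>a\<close> meet on \<open>H\<close>.  Injectivity of \<open>c\<close> says that the lines
  are distinct and that the chart is generic: all intersection points are at finite distance.
\<close>

locale plane_lines =
  fixes N :: nat and a c :: "nat \<Rightarrow> 'f::field"
  assumes inj_c: "inj_on c {..<N}"
begin

definition parallels :: "nat \<Rightarrow> nat set" where
  "parallels k = {j. j < k \<and> a j = a k}"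

text \<open>The lines are graphs over \<open>z\<close>, so the \<open>z\<close>-coordinate alone
  names a point of line \<open>k\<close>. Intersections on \<open>H\<close> have
  \<open>z = 0\<close> and are kept apart as \<open>parallels\<close>.\<close>

definition meet :: "nat \<Rightarrow> nat \<Rightarrow> 'f" where
  "meet k j = (a k - a j) / (c j - c k)"

definition meets :: "nat \<Rightarrow> 'f set" where
  "meets k = meet k ` {j. j < k \<and> a j \<noteq> a k}"

definition through :: "nat \<Rightarrow> 'f \<Rightarrow> nat set" where
  "through k z = {j. j < k \<and> a j \<noteq> a k \<and> meet k j = z}"

text \<open>
  In the affine coordinates \<open>x = 1 / z\<close>, \<open>y = s / z\<close> the pair \<open>(P, Q)\<close> is a vector field, and
  the residue is its component normal to line \<open>k\<close>.
\<close>

definition residue_on :: "nat \<Rightarrow> 'f poly poly \<Rightarrow> 'f poly poly \<Rightarrow> 'f poly" where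
  "residue_on k P Q = poly (Q - smult [:a k:] P) [:a k, c k:]"

definition tangent :: "nat \<Rightarrow> nat \<Rightarrow> 'f poly poly \<Rightarrow> 'f poly poly \<Rightarrow> bool" where
  "tangent k D P Q \<longleftrightarrow> deg_lt D P \<and> deg_lt D Q \<and> (\<forall>j<k. residue_on j P Q = 0)"

lemma finite_sets [simp]: "finite (parallels k)" "finite (meets k)" "finite (through k z)"
  by (simp_all add: parallels_def meets_def through_def)

lemma c_neq: "i < N \<Longrightarrow> j < N \<Longrightarrow> i \<noteq> j \<Longrightarrow> c i \<noteq> c j"
  using inj_c by (auto simp: inj_on_def)

lemma meet_nonzero: "k < N \<Longrightarrow> z \<in> meets k \<Longrightarrow> z \<noteq> 0"
  using c_neq by (auto simp: meets_def meet_def)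

lemma through_point: "k < N \<Longrightarrow> j \<in> through k z \<Longrightarrow> a j + c j * z = a k + c k * z"
  using c_neq[of j k] by (auto simp: through_def meet_def field_simps)

text \<open>The left-hand side of \<open>sum_multiplicities\<close> counts the zeros that tangency
  to the earlier lines forces on the normal component along line \<open>k\<close>: as many as there
  are lines at \<open>z = 0\<close>, but one less at every other point.\<close>

lemma card_meets_le: "card (meets k) + card (parallels k) \<le> k"
  and sum_multiplicities: "card (parallels k) + (\<Sum>z\<in>meets k. card (through k z) - 1) = k - card (meets k)"
proof -
  let ?J = "{j. j < k \<and> a j \<noteq> a k}"
  have split: "card (parallels k) + card ?J = k"
  proof -
    have "parallels k \<union> ?J = {..<k}" "parallels k \<inter> ?J = {}" by (auto simp: parallels_def)
    then show ?thesis by (metis card_Un_disjoint card_lessThan finite_Un finite_lessThan)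
  qed
  show "card (meets k) + card (parallels k) \<le> k"
    using card_image_le[of ?J "meet k"] split by (simp add: meets_def)
  have "card ?J = card (\<Union>z\<in>meets k. through k z)"
    by (rule arg_cong[of _ _ card]) (auto simp: meets_def through_def)
  also have "\<dots> = (\<Sum>z\<in>meets k. card (through k z))"
    by (intro card_UN_disjoint) (auto simp: through_def)
  also have "\<dots> = (\<Sum>z\<in>meets k. (card (through k z) - 1) + 1)"
  proof (rule sum.cong[OF refl])
    fix z assume "z \<in> meets k"
    then have "through k z \<noteq> {}" by (auto simp: meets_def through_def)
    then show "card (through k z) = card (through k z) - 1 + 1"
      by (simp add: card_gt_0_iff Suc_leI)
  qed
  finally have "card ?J = (\<Sum>z\<in>meets k. card (through k z) - 1) + card (meets k)"
    by (simp only: sum.distrib) simp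
  with split show "card (parallels k) + (\<Sum>z\<in>meets k. card (through k z) - 1) = k - card (meets k)"
    by linarith
qed

text \<open>\<open>F\<close> is divisible by the equations of the lines in \<open>J\<close>, and
  each equation, restricted to line \<open>k\<close>, vanishes at \<open>z\<close>.\<close>

lemma power_dvd_on_line:
  assumes "J \<subseteq> {..<N}" "\<And>j. j \<in> J \<Longrightarrow> poly F [:a j, c j:] = 0"
    and "\<And>j. j \<in> J \<Longrightarrow> a j + c j * z = a k + c k * z"
  shows "[:-z, 1:] ^ card J dvd poly F [:a k, c k:]"
proof -
  have J: "finite J" using assms(1) by (rule finite_subset) simp
  have inj: "inj_on (\<lambda>j. [:a j, c j:]) J"
    using inj_on_subset[OF inj_c assms(1)] by (auto simp: inj_on_def)
  have "(\<Prod>\<rho>\<in>(\<lambda>j. [:a j, c j:]) ` J. [:-\<rho>, 1:]) dvd F"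
    using J assms(2) by (intro prod_linear_factors_dvd) auto
  then obtain G where "F = (\<Prod>j\<in>J. [:-[:a j, c j:], 1:]) * G"
    using inj by (auto simp: prod.reindex elim: dvdE)
  then have F: "poly F [:a k, c k:] = (\<Prod>j\<in>J. [:a k - a j, c k - c j:]) * poly G [:a k, c k:]"
    by (simp add: poly_prod)
  have "(\<Prod>j\<in>J. [:-z, 1:]) dvd (\<Prod>j\<in>J. [:a k - a j, c k - c j:])"
  proof (rule prod_dvd_prod)
    fix j assume "j \<in> J"
    then have "poly [:a k - a j, c k - c j:] z = 0" using assms(3)[of j] by (simp add: algebra_simps)
    then show "[:-z, 1:] dvd [:a k - a j, c k - c j:]" by (rule poly_eq_0_iff_dvd[THEN iffD1])
  qed
  then show ?thesis unfolding F by (simp add: dvd_mult2)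
qed

text \<open>Lines with equal \<open>a\<close> share the normal component \<open>Q - a k * P\<close>
  on the whole plane. Hence no order is lost here, in contrast to points off
  \<open>H\<close>.\<close>

lemma residue_multiplicity_parallels:
  assumes "k < N" "\<forall>j<k. residue_on j P Q = 0"
  shows "[:-0, 1:] ^ card (parallels k) dvd residue_on k P Q"
  unfolding residue_on_def
proof (rule power_dvd_on_line)
  fix j assume "j \<in> parallels k"
  then show "poly (Q - smult [:a k:] P) [:a j, c j:] = 0"
    using assms(2) by (auto simp: parallels_def residue_on_def)
qed (use assms in \<open>auto simp: parallels_def\<close>)

lemma residue_multiplicity_point:
  assumes k: "k < N" and res: "\<forall>j<k. residue_on j P Q = 0"
  shows "[:-z, 1:] ^ (card (through k z) - 1) dvd residue_on k P Q"
proof (cases "card (through k z)")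
  case (Suc m)
  define s where "s = a k + c k * z"
  \<comment> \<open>The determinant of the field and the Euler field centred at the point \<open>(z, s)\<close>: it vanishes on
    every line through that point to which the field is tangent.\<close>
  define W where "W = P * [:[:0, -s:], [:z:]:] - Q * [:[:z, -1:]:]"
  have W: "poly W [:a j, c j:] = [:-z, 1:] * residue_on j P Q" if "a j + c j * z = s" for j
  proof -
    have "[:0, -s:] + [:a j, c j:] * [:z:] = - smult (a j) [:-z, 1:]"
      using that[symmetric] by (simp add: algebra_simps)
    moreover have "[:z, -1:] = - [:-z, 1:]" by simp
    ultimately have "poly W [:a j, c j:]
        = poly P [:a j, c j:] * (- smult (a j) [:-z, 1:]) - poly Q [:a j, c j:] * (- [:-z, 1:])"
      by (simp only: W_def poly_diff poly_mult poly_pCons poly_0 mult_zero_right add_0_right)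
    also have "p * (- smult t L) - q * (- L) = L * (q - [:t:] * p)" for p q L :: "'f poly" and t
      by (simp add: algebra_simps)
    finally show ?thesis by (simp only: residue_on_def poly_diff poly_smult)
  qed
  have "[:-z, 1:] ^ card (through k z) dvd poly W [:a k, c k:]"
  proof (rule power_dvd_on_line)
    fix j assume j: "j \<in> through k z"
    then show "a j + c j * z = a k + c k * z" using through_point k by simp
    with W[of j] res j show "poly W [:a j, c j:] = 0" by (simp add: s_def through_def)
  qed (use k in \<open>auto simp: through_def\<close>)
  \<comment> \<open>The extra factor \<open>[:-z, 1:]\<close> is the price of passing from the
    residue to \<open>W\<close>; cancelling it loses one order.\<close>
  also have "poly W [:a k, c k:] = [:-z, 1:] * residue_on k P Q" by (rule W) (simp add: s_def)
  finally have "[:-z, 1:] * [:-z, 1:] ^ m dvd [:-z, 1:] * residue_on k P Q"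
    by (simp only: Suc power_Suc)
  then have "[:-z, 1:] ^ m dvd residue_on k P Q"
    by (subst (asm) dvd_mult_cancel_left) simp
  then show ?thesis using Suc by simp
qed simp

lemma pfunctional_residue: "pfunctional (residue_on k)"
  unfolding pfunctional_def residue_on_def by (simp add: algebra_simps smult_add_right smult_diff_right)

lemma detect_add_line:
  assumes k: "k < N" "k \<le> D" and "detect (tangent (Suc k) D) n"
  shows "detect (tangent k D) (n + (D - (k - card (meets k))))"
proof -
  \<comment> \<open>Once these coefficients vanish, the degree of the residue is below
    \<open>k - card (meets k)\<close>, the number of its forced zeros.\<close>
  let ?I = "{k - card (meets k)..<D}"
  have "detect (tangent k D) (n + card ?I)"
  proof (rule detect_extend[where f = "residue_on k"])
    have "tangent (Suc k) D = (\<lambda>P Q. tangent k D P Q \<and> residue_on k P Q = 0)"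
      by (auto simp: tangent_def fun_eq_iff less_Suc_eq)
    then show "detect (\<lambda>P Q. tangent k D P Q \<and> residue_on k P Q = 0) n" using assms(3) by simp
  next
    fix P Q assume PQ: "tangent k D P Q" and zero: "\<And>i. i \<in> ?I \<Longrightarrow> coeff (residue_on k P Q) i = 0"
    show "residue_on k P Q = 0"
    proof (rule poly_eq_0_if_multiplicities)
      show "finite (insert 0 (meets k))" by simp
      show "[:-z, 1:] ^ (if z = 0 then card (parallels k) else card (through k z) - 1) dvd residue_on k P Q" for z
        using residue_multiplicity_parallels[OF k(1)] residue_multiplicity_point[OF k(1)] PQ
        by (auto simp: tangent_def)
      have "(\<Sum>z\<in>meets k. if z = 0 then card (parallels k) else card (through k z) - 1)
          = (\<Sum>z\<in>meets k. card (through k z) - 1)"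
        using meet_nonzero[OF k(1)] by (intro sum.cong) auto
      then show "k - card (meets k)
          \<le> (\<Sum>z\<in>insert 0 (meets k). if z = 0 then card (parallels k) else card (through k z) - 1)"
        using meet_nonzero[OF k(1), of 0] sum_multiplicities[of k] by (subst sum.insert) auto
      have "coeff (residue_on k P Q) i = 0" if "D \<le> i" for i
        using PQ that unfolding residue_on_def tangent_def
        by (intro coeff_poly_line[of D]) (auto intro: deg_lt_diff deg_lt_smult)
      then show "coeff (residue_on k P Q) i = 0" if "k - card (meets k) \<le> i" for i
        using that zero[of i] by (cases "i < D") auto
    qed
  qed (simp_all add: pfunctional_residue)
  then show ?thesis by simp
qed

end

section \<open>Leading parts of vector fields: restriction to \<open>H\<close>, where
  \<open>z = 0\<close>\<close>

definition at_infinity_line :: "'f::field poly poly \<Rightarrow> 'f poly" where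
  "at_infinity_line P = map_poly (\<lambda>p. coeff p 0) P"

text \<open>Dropping the constant coefficient in \<open>z\<close> is division by \<open>z\<close>
  when the restriction to \<open>H\<close> is zero; it then lowers the degree of the field by
  one.\<close>

definition divide_z :: "'f::field poly poly \<Rightarrow> 'f poly poly" where
  "divide_z P = map_poly (poly_shift 1) P"

lemma coeff_at_infinity_line [simp]: "coeff (at_infinity_line P) i = coeff (coeff P i) 0"
  by (simp add: at_infinity_line_def coeff_map_poly)

lemma coeff_divide_z [simp]: "coeff (coeff (divide_z P) i) j = coeff (coeff P i) (Suc j)"
  by (simp add: divide_z_def coeff_map_poly coeff_poly_shift)

lemma at_infinity_line_simps [simp]:
  "at_infinity_line (P + Q) = at_infinity_line P + at_infinity_line Q"
  "at_infinity_line (P - Q) = at_infinity_line P - at_infinity_line Q"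
  "at_infinity_line (smult [:t:] P) = smult t (at_infinity_line P)"
  "at_infinity_line (P * Q) = at_infinity_line P * at_infinity_line Q"
  "at_infinity_line 1 = 1"
  "at_infinity_line [:-[:u, v:], 1:] = [:-u, 1:]"
  by (rule poly_eqI, simp add: coeff_mult coeff_sum coeff_mult_0 coeff_pCons split: nat.splits)+

lemma at_infinity_line_prod: "at_infinity_line (\<Prod>j\<in>J. f j) = (\<Prod>j\<in>J. at_infinity_line (f j))"
  by (induction J rule: infinite_finite_induct) auto

lemma divide_z_simps:
  "divide_z (P + Q) = divide_z P + divide_z Q"
  "divide_z (smult [:t:] P) = smult [:t:] (divide_z P)"
  by (rule poly_eqI, rule poly_eqI, simp)+

lemma divide_z_cancel:
  assumes "at_infinity_line P = 0"
  shows "P = smult [:0, 1:] (divide_z P)"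
proof (rule poly_eqI, rule poly_eqI)
  fix i j
  have "coeff (coeff P i) 0 = 0" using assms by (metis coeff_0 coeff_at_infinity_line)
  then show "coeff (coeff P i) j = coeff (coeff (smult [:0, 1:] (divide_z P)) i) j"
    by (cases j) auto
qed

lemma deg_lt_divide_z: "deg_lt (Suc D) P \<Longrightarrow> deg_lt D (divide_z P)"
  unfolding deg_lt_def by fastforce

lemma deg_lt_at_infinity_line: "deg_lt D P \<Longrightarrow> D \<le> i \<Longrightarrow> coeff (at_infinity_line P) i = 0"
  unfolding deg_lt_def by fastforce

context plane_lines
begin

text \<open>The lines of slope \<open>\<alpha>\<close> share the component
  \<open>Q - \<alpha> * P\<close>, which the product of their equations divides. At
  \<open>z = 0\<close> all these equations become \<open>s - \<alpha>\<close>.\<close>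

lemma slope_multiplicity:
  assumes "tangent N D P Q"
  shows "[:-\<alpha>, 1:] ^ card {j. j < N \<and> a j = \<alpha>} dvd at_infinity_line Q - smult \<alpha> (at_infinity_line P)"
proof -
  let ?J = "{j. j < N \<and> a j = \<alpha>}"
  have inj: "inj_on (\<lambda>j. [:a j, c j:]) ?J"
    using inj_c by (auto simp: inj_on_def)
  have "(\<Prod>\<rho>\<in>(\<lambda>j. [:a j, c j:]) ` ?J. [:-\<rho>, 1:]) dvd Q - smult [:\<alpha>:] P"
    using assms by (intro prod_linear_factors_dvd) (auto simp: tangent_def residue_on_def)
  then have "(\<Prod>j\<in>?J. [:-[:a j, c j:], 1:]) dvd Q - smult [:\<alpha>:] P"
    by (subst (asm) prod.reindex[OF inj]) (simp only: o_def)
  then obtain G where "Q - smult [:\<alpha>:] P = (\<Prod>j\<in>?J. [:-[:a j, c j:], 1:]) * G"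
    by (rule dvdE)
  then have "at_infinity_line (Q - smult [:\<alpha>:] P) = at_infinity_line ((\<Prod>j\<in>?J. [:-[:a j, c j:], 1:]) * G)"
    by simp
  also have "\<dots> = (\<Prod>j\<in>?J. [:-a j, 1:]) * at_infinity_line G"
    by (simp only: at_infinity_line_simps at_infinity_line_prod)
  also have "(\<Prod>j\<in>?J. [:-a j, 1:]) = (\<Prod>j\<in>?J. [:-\<alpha>, 1:])" by (intro prod.cong) auto
  finally show ?thesis by simp
qed

text \<open>A tangent field that vanishes on \<open>H\<close> is \<open>z\<close> times a tangent
  field of lower degree, since \<open>z\<close> factors out of every residue as well. Composing the
  functionals with \<open>divide_z\<close> carries the bound over.\<close>

lemma detect_divisible_by_z:
  assumes "detect (tangent N D) n"
  shows "detect (\<lambda>P Q. tangent N (Suc D) P Q \<and> at_infinity_line P = 0 \<and> at_infinity_line Q = 0) n"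
proof -
  obtain \<Phi> where \<Phi>: "finite \<Phi>" "card \<Phi> \<le> n" "\<forall>\<phi>\<in>\<Phi>. functional \<phi>"
    and inj: "\<forall>P Q. tangent N D P Q \<longrightarrow> (\<forall>\<phi>\<in>\<Phi>. \<phi> P Q = 0) \<longrightarrow> P = 0 \<and> Q = 0"
    using assms unfolding detect_def by (elim exE conjE) (rule that)
  let ?g = "\<lambda>\<phi> P Q. \<phi> (divide_z P) (divide_z Q)"
  show ?thesis unfolding detect_def
  proof (rule exI[of _ "?g ` \<Phi>"], intro conjI allI impI)
    show "card (?g ` \<Phi>) \<le> n" using card_image_le[OF \<Phi>(1), of ?g] \<Phi>(2) by simp
    show "\<forall>\<phi>\<in>?g ` \<Phi>. functional \<phi>"
    proof
      fix \<psi> assume "\<psi> \<in> ?g ` \<Phi>"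
      then obtain \<phi> where "functional \<phi>" "\<psi> = ?g \<phi>" using \<Phi>(3) by blast
      then show "functional \<psi>" by (simp only: functional_def divide_z_simps simp_thms)
    qed
    fix P Q assume PQ: "tangent N (Suc D) P Q \<and> at_infinity_line P = 0 \<and> at_infinity_line Q = 0"
      and zero: "\<forall>\<phi>\<in>?g ` \<Phi>. \<phi> P Q = 0"
    define P' Q' where "P' = divide_z P" and "Q' = divide_z Q"
    have P: "P = smult [:0, 1:] P'" and Q: "Q = smult [:0, 1:] Q'"
      using PQ divide_z_cancel by (auto simp: P'_def Q'_def)
    have "residue_on j P' Q' = 0" if "j < N" for j
    proof -
      have "residue_on j P Q = [:0, 1:] * residue_on j P' Q'"
        unfolding residue_on_def P Q by (simp add: algebra_simps smult_diff_right)
      moreover have "residue_on j P Q = 0" using PQ that by (simp add: tangent_def)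
      ultimately show ?thesis by (metis mult_eq_0_iff pCons_eq_0_iff zero_neq_one)
    qed
    then have "tangent N D P' Q'"
      using PQ by (auto simp: tangent_def P'_def Q'_def deg_lt_divide_z)
    moreover have "\<forall>\<phi>\<in>\<Phi>. \<phi> P' Q' = 0" using zero by (auto simp: P'_def Q'_def)
    ultimately have "P' = 0 \<and> Q' = 0" using inj by simp
    then show "P = 0" "Q = 0" using P Q by auto
  qed (use \<Phi>(1) in simp)
qed

abbreviation "slopes \<equiv> a ` {..<N}"

lemma sum_slope_multiplicities:
  "(\<Sum>\<alpha>\<in>slopes. card {j. j < N \<and> a j = \<alpha>} - 1) = N - card slopes"
proof -
  have "{..<N} = (\<Union>\<alpha>\<in>slopes. {j. j < N \<and> a j = \<alpha>})" by auto
  then have "N = card (\<Union>\<alpha>\<in>slopes. {j. j < N \<and> a j = \<alpha>})" by (metis card_lessThan)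
  also have "\<dots> = (\<Sum>\<alpha>\<in>slopes. card {j. j < N \<and> a j = \<alpha>})"
    by (intro card_UN_disjoint) auto
  also have "\<dots> = (\<Sum>\<alpha>\<in>slopes. (card {j. j < N \<and> a j = \<alpha>} - 1) + 1)"
  proof (rule sum.cong[OF refl])
    fix \<alpha> assume "\<alpha> \<in> slopes"
    then have "{j. j < N \<and> a j = \<alpha>} \<noteq> {}" by auto
    then show "card {j. j < N \<and> a j = \<alpha>} = card {j. j < N \<and> a j = \<alpha>} - 1 + 1"
      by (simp add: card_gt_0_iff Suc_leI)
  qed
  finally show ?thesis by (simp only: sum.distrib) simp
qed

lemma detect_increase_degree:
  assumes "detect (tangent N D) n"
  shows "detect (tangent N (Suc D)) (n + (D - (N - card slopes)) + (D + 2 - card slopes))"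
proof -
  let ?w = "\<lambda>P Q. [:0, 1:] * at_infinity_line P - at_infinity_line Q"
  let ?S = "\<lambda>P Q. tangent N (Suc D) P Q \<and> ?w P Q = 0"
  \<comment> \<open>On \<open>z = 0\<close> the polynomial \<open>?w\<close> has all slopes as roots.  If it is zero, then the field restricts
    to \<open>(p, s * p)\<close>, and \<open>m\<close> lines of slope \<open>\<alpha>\<close> force a root of \<open>p\<close> of order \<open>m - 1\<close> at \<open>\<alpha>\<close>.\<close>
  have "detect ?S (n + card {N - card slopes..<D})"
  proof (rule detect_extend[where f = "\<lambda>P Q. at_infinity_line P"])
    have "(\<lambda>P Q. ?S P Q \<and> at_infinity_line P = 0)
        = (\<lambda>P Q. tangent N (Suc D) P Q \<and> at_infinity_line P = 0 \<and> at_infinity_line Q = 0)"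
      by (auto simp: fun_eq_iff)
    with detect_divisible_by_z[OF assms]
    show "detect (\<lambda>P Q. ?S P Q \<and> at_infinity_line P = 0) n" by simp
  next
    fix P Q assume PQ: "?S P Q"
      and zero: "\<And>i. i \<in> {N - card slopes..<D} \<Longrightarrow> coeff (at_infinity_line P) i = 0"
    let ?p = "at_infinity_line P"
    have q: "at_infinity_line Q = [:0, 1:] * ?p" using PQ by simp
    show "?p = 0"
    proof (rule poly_eq_0_if_multiplicities)
      show "N - card slopes \<le> (\<Sum>\<alpha>\<in>slopes. card {j. j < N \<and> a j = \<alpha>} - 1)"
        by (simp only: sum_slope_multiplicities)
      fix \<alpha> assume "\<alpha> \<in> slopes"
      show "[:-\<alpha>, 1:] ^ (card {j. j < N \<and> a j = \<alpha>} - 1) dvd ?p"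
      proof (cases "card {j. j < N \<and> a j = \<alpha>}")
        case (Suc m)
        have "at_infinity_line Q - smult \<alpha> ?p = [:-\<alpha>, 1:] * ?p" using q by simp
        then have "[:-\<alpha>, 1:] * [:-\<alpha>, 1:] ^ m dvd [:-\<alpha>, 1:] * ?p"
          using slope_multiplicity[of "Suc D" P Q \<alpha>] PQ by (simp only: Suc power_Suc)
        then have "[:-\<alpha>, 1:] ^ m dvd ?p" by (subst (asm) dvd_mult_cancel_left) simp
        then show ?thesis using Suc by simp
      next
        case 0
        then show ?thesis by (simp only: diff_0_eq_0 power_0 one_dvd)
      qed
    next
      fix i assume i: "N - card slopes \<le> i"
      show "coeff ?p i = 0"
      proof (cases "i < D")
        case True
        with zero i show ?thesis by simp
      next
        case False
        \<comment> \<open>On \<open>H\<close> the component \<open>Q\<close> is \<open>s * p\<close>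
          and has degree at most \<open>D\<close>, so \<open>p\<close> has degree below
          \<open>D\<close>. This is why the index range ends at \<open>D\<close> and not at
          \<open>Suc D\<close>.\<close>
        then have "coeff (at_infinity_line Q) (Suc i) = 0"
          using PQ by (intro deg_lt_at_infinity_line[of "Suc D"]) (auto simp: tangent_def)
        then show ?thesis unfolding q by simp
      qed
    qed simp
  qed (auto simp: pfunctional_def)
  \<comment> \<open>\<open>?w\<close> has degree at most \<open>D + 1\<close>, because
    \<open>P\<close> is multiplied by \<open>s\<close>, and every slope is a root: this leaves
    \<open>D + 2 - card slopes\<close> conditions.\<close>
  moreover have "detect (tangent N (Suc D)) (m + card {card slopes..<D + 2})" if "detect ?S m" for m
  proof (rule detect_extend[OF that])
    show "pfunctional ?w"
      by (auto simp: pfunctional_def algebra_simps smult_diff_right)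
    fix P Q assume PQ: "tangent N (Suc D) P Q" and zero: "\<And>i. i \<in> {card slopes..<D + 2} \<Longrightarrow> coeff (?w P Q) i = 0"
    show "?w P Q = 0"
    proof (rule poly_eq_0_if_multiplicities)
      fix \<alpha> assume "\<alpha> \<in> slopes"
      then have "{j. j < N \<and> a j = \<alpha>} \<noteq> {}" by auto
      then have "card {j. j < N \<and> a j = \<alpha>} \<noteq> 0" by simp
      then have "[:-\<alpha>, 1:] dvd [:-\<alpha>, 1:] ^ card {j. j < N \<and> a j = \<alpha>}"
        by (intro dvd_power disjI1) (simp add: card_gt_0_iff)
      then have "[:-\<alpha>, 1:] dvd at_infinity_line Q - smult \<alpha> (at_infinity_line P)"
        using slope_multiplicity[OF PQ, of \<alpha>] by (rule dvd_trans)
      then have "[:-\<alpha>, 1:] dvd [:-\<alpha>, 1:] * at_infinity_line P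
          - (at_infinity_line Q - smult \<alpha> (at_infinity_line P))" by (rule dvd_diff[OF dvd_triv_left])
      then show "[:-\<alpha>, 1:] ^ 1 dvd ?w P Q" by simp
    next
      fix i assume i: "card slopes \<le> i"
      show "coeff (?w P Q) i = 0"
      proof (cases "i < D + 2")
        case False
        then obtain l where "i = Suc l" "Suc D \<le> l" by (cases i) auto
        then show ?thesis
          using PQ deg_lt_at_infinity_line[of "Suc D" P l] deg_lt_at_infinity_line[of "Suc D" Q i]
          by (simp add: tangent_def)
      qed (use zero i in simp)
    qed auto
  qed simp
  ultimately show ?thesis by simp
qed

lemma detect_tangent_all:
  "detect (tangent N D) (\<Sum>\<delta><D. (\<delta> - (N - card slopes)) + (\<delta> + 2 - card slopes))"
proof (induction D)
  case 0
  have "tangent N 0 P Q \<Longrightarrow> P = 0 \<and> Q = 0" for P Q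
    by (auto simp: tangent_def deg_lt_def poly_eq_iff)
  then show ?case unfolding detect_def by (intro exI[of _ "{}"]) auto
next
  case (Suc D)
  from detect_increase_degree[OF this] show ?case by (simp add: add.assoc)
qed

text \<open>Downward induction: giving up tangency to line \<open>k\<close> enlarges the space by at
  most the free coefficients of its normal component. At \<open>k = 0\<close> only the degree bound
  remains.\<close>

lemma detect_tangent_some:
  assumes "k \<le> N"
  shows "detect (tangent k N) ((\<Sum>\<delta><N. (\<delta> - (N - card slopes)) + (\<delta> + 2 - card slopes))
    + (\<Sum>i=k..<N. N - (i - card (meets i))))"
  using assms
proof (induction k rule: inc_induct)
  case base
  then show ?case using detect_tangent_all by simp
next
  case (step k)
  from detect_add_line[OF step(2) _ step(3)] step(2) show ?case
    by (simp add: sum.atLeast_Suc_lessThan algebra_simps)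
qed

text \<open>A point off \<open>H\<close> on \<open>m\<close> lines is counted for each of them but
  the first, so the right-hand side is the sum of \<open>m - 1\<close> over these points. The proof
  compares the bound for \<open>k = 0\<close> with the dimension \<open>N * (N + 1)\<close>. Degree
  bound \<open>N\<close> is large enough that no \<open>N - (i - card (meets i))\<close> is
  truncated; a larger one would give the same inequality.\<close>

theorem planar_inequality: "(card slopes - 1) * (N + 1 - card slopes) \<le> (\<Sum>k<N. card (meets k))"
proof (cases "N = 0")
  case False
  define r where "r = card slopes"
  have "slopes \<noteq> {}" using False by auto
  then have r: "1 \<le> r" "r \<le> N"
    using card_image_le[of "{..<N}" a] by (simp_all add: r_def card_gt_0_iff Suc_leI)
  have *: "(\<Sum>\<delta><n. \<delta> - m) * 2 = (n - m) * (n - m - 1)" for n m :: nat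
  proof (induction n)
    case (Suc n)
    show ?case
    proof (cases "n < m")
      case False
      then obtain d where "n = m + d" by (metis add_diff_inverse_nat)
      with Suc show ?thesis by (cases d) (simp_all add: algebra_simps)
    qed (use Suc in simp)
  qed simp
  have **: "(\<Sum>\<delta><n. \<delta> + 2 - Suc m) * 2 = (n + 1 - m) * (n - m)" for n m :: nat
  proof (induction n)
    case (Suc n)
    show ?case
    proof (cases "n < m")
      case True
      then have "n = m - 1 \<or> n + 1 < m" by linarith
      with True Suc show ?thesis by auto
    next
      case False
      then obtain d where "n = m + d" by (metis add_diff_inverse_nat)
      with Suc show ?thesis by (simp_all add: algebra_simps)
    qed
  qed simp
  have "tangent 0 N = (\<lambda>P Q. deg_lt N P \<and> deg_lt N Q)" by (auto simp: tangent_def fun_eq_iff)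
  then have "N * (N + 1) \<le> (\<Sum>\<delta><N. (\<delta> - (N - r)) + (\<delta> + 2 - r)) + (\<Sum>i<N. N - (i - card (meets i)))"
    using detect_tangent_some[of 0] detect_all_lower_bound[of N]
    by (simp add: r_def atLeast0LessThan)
  also have "(\<Sum>i<N. N - (i - card (meets i))) = (\<Sum>i<N. (N - i) + card (meets i))"
  proof (rule sum.cong[OF refl])
    fix i assume "i \<in> {..<N}"
    then show "N - (i - card (meets i)) = (N - i) + card (meets i)" using card_meets_le[of i] by simp
  qed
  finally have ineq: "2 * (N * (N + 1)) \<le> (\<Sum>\<delta><N. \<delta> - (N - r)) * 2 + (\<Sum>\<delta><N. \<delta> + 2 - r) * 2
      + (\<Sum>i<N. N - i) * 2 + 2 * (\<Sum>i<N. card (meets i))"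
    unfolding sum.distrib by linarith
  have "{(i, j). i + j < N} = (SIGMA i:{..<N}. {..<N - i})" by auto
  then have tri: "(\<Sum>i<N. N - i) * 2 = N * (N + 1)" using card_triangle[of N] by simp
  have s1: "(\<Sum>\<delta><N. \<delta> - (N - r)) * 2 = r * (r - 1)" using *[of "N - r" N] r by simp
  obtain m where m: "r = Suc m" using r by (cases r) auto
  have s2: "(\<Sum>\<delta><N. \<delta> + 2 - r) * 2 = (N + 1 - m) * (N - m)" using **[of m N] m by simp
  obtain d where d: "N = m + 1 + d" using r m by (metis Suc_eq_plus1 le_Suc_ex)
  \<comment> \<open>The closed forms combine by \<open>(m + d + 1) * (m + d + 2) - m * (m + 1) - (d
    + 1) * (d + 2) = 2 * m * (d + 1)\<close>.\<close>
  have "2 * (m * (d + 1)) \<le> 2 * (\<Sum>i<N. card (meets i))"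
    using ineq unfolding tri s1 s2 unfolding m d by (simp add: algebra_simps)
  then show ?thesis unfolding r_def[symmetric] m by (simp add: d algebra_simps)
qed simp

end

section \<open>From points with homogeneous coordinates to lines in a chart\<close>

lemma card_image_eq_kernel:
  assumes "\<And>x y. x \<in> J \<Longrightarrow> y \<in> J \<Longrightarrow> f x = f y \<longleftrightarrow> g x = g y"
  shows "card (f ` J) = card (g ` J)"
proof -
  define \<phi> where "\<phi> z = g (SOME x. x \<in> J \<and> f x = z)" for z
  have \<phi>: "\<phi> (f x) = g x" if "x \<in> J" for x
    using someI[of "\<lambda>y. y \<in> J \<and> f y = f x" x] assms that unfolding \<phi>_def by blast
  have "bij_betw \<phi> (f ` J) (g ` J)"
    unfolding bij_betw_def using \<phi> assms by (auto simp: inj_on_def image_iff)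
  then show ?thesis by (rule bij_betw_same_card)
qed

definition det3 :: "'f::field \<times> 'f \<times> 'f \<Rightarrow> 'f \<times> 'f \<times> 'f \<Rightarrow> 'f \<times> 'f \<times> 'f \<Rightarrow> 'f" where
  "det3 = (\<lambda>(u1, v1, w1) (u2, v2, w2) (u3, v3, w3).
     u1 * (v2 * w3 - v3 * w2) - v1 * (u2 * w3 - u3 * w2) + w1 * (u2 * v3 - u3 * v2))"

text \<open>Point \<open>i\<close> has homogeneous coordinates \<open>(u i, v i, w i)\<close> and is
  projected from \<open>(0, 0, 1)\<close>; \<open>cl\<close> is its image and \<open>lin k j\<close>
  the line joining two points. A change of coordinates and scaling turn it into
  \<open>(a, 1, c)\<close>, up to sign the coefficients of the line \<open>s = a + c * z\<close>.
  Only the kernels of \<open>cl\<close> and \<open>lin\<close> enter, so their types are independent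
  of the field, which may then be extended.\<close>

lemma triples_inequality_infinite:
  fixes u v w :: "nat \<Rightarrow> 'f::field" and cl :: "nat \<Rightarrow> 'c" and lin :: "nat \<Rightarrow> nat \<Rightarrow> 'l"
  assumes inf: "infinite (UNIV :: 'f set)"
    and uv: "\<And>i. i < N \<Longrightarrow> u i \<noteq> 0 \<or> v i \<noteq> 0"
    and npar: "\<And>i j. i < N \<Longrightarrow> j < N \<Longrightarrow> i \<noteq> j \<Longrightarrow> u i * v j = u j * v i \<Longrightarrow>
      u i * w j \<noteq> u j * w i \<or> v i * w j \<noteq> v j * w i"
    and cl: "\<And>i j. i < N \<Longrightarrow> j < N \<Longrightarrow> cl i = cl j \<longleftrightarrow> u i * v j = u j * v i"
    and lin: "\<And>i j k. i < N \<Longrightarrow> j < N \<Longrightarrow> k < N \<Longrightarrow> cl i \<noteq> cl k \<Longrightarrow> cl j \<noteq> cl k \<Longrightarrow>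
      lin k j = lin k i \<longleftrightarrow> det3 (u k, v k, w k) (u j, v j, w j) (u i, v i, w i) = 0"
  shows "(card (cl ` {..<N}) - 1) * (N + 1 - card (cl ` {..<N}))
    \<le> (\<Sum>k<N. card (lin k ` {j. j < k \<and> cl j \<noteq> cl k}))"
proof -
  \<comment> \<open>\<open>\<kappa>\<close> makes every \<open>V i\<close> nonzero. Where
    \<open>u i = 0\<close>, the quotient is 0 and merely excludes one more value.\<close>
  obtain \<kappa> where \<kappa>: "\<kappa> \<notin> (\<lambda>i. - v i / u i) ` {..<N}"
    using ex_new_if_finite[OF inf, of "(\<lambda>i. - v i / u i) ` {..<N}"] by auto
  define V where "V i = v i + \<kappa> * u i" for i
  have V: "V i \<noteq> 0" if "i < N" for i
  proof
    assume "V i = 0"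
    then have "u i \<noteq> 0" using uv[OF that] by (auto simp: V_def)
    with \<open>V i = 0\<close> have "\<kappa> = - v i / u i" by (simp add: V_def field_simps eq_neg_iff_add_eq_0)
    with \<kappa> that show False by blast
  qed
  \<comment> \<open>These are the solutions \<open>\<mu>\<close> of \<open>c i = c j\<close>. Pairs
    with zero denominator lie in one class and are separated by \<open>npar\<close> instead.\<close>
  let ?bad = "\<lambda>(i, j). (w j * V i - w i * V j) / (u i * V j - u j * V i)"
  obtain \<mu> where \<mu>: "\<mu> \<notin> ?bad ` ({..<N} \<times> {..<N})"
    using ex_new_if_finite[OF inf, of "?bad ` ({..<N} \<times> {..<N})"] by auto
  define a where "a i = u i / V i" for i
  define c where "c i = (w i + \<mu> * u i) / V i" for i
  have uV: "u i * V j - u j * V i = u i * v j - u j * v i" for i j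
    by (simp add: V_def algebra_simps)
  have a_eq: "a i = a j \<longleftrightarrow> cl i = cl j" if "i < N" "j < N" for i j
    using V[OF that(1)] V[OF that(2)] cl[OF that] uV[of i j] by (auto simp: a_def field_simps)
  have c_neq: "c i \<noteq> c j" if ij: "i < N" "j < N" "i \<noteq> j" for i j
  proof
    assume "c i = c j"
    then have eq: "\<mu> * (u i * V j - u j * V i) = w j * V i - w i * V j"
      using V ij by (simp add: c_def field_simps)
    show False
    proof (cases "u i * v j = u j * v i")
      case True
      then have uu: "u i * V j = u j * V i" using uV[of i j] by simp
      have vv: "v i * V j = v j * V i" using True by (simp add: V_def algebra_simps)
      have ww: "w i * V j = w j * V i" using eq uu by simp
      have nz: "V i * V j \<noteq> 0" using V ij by simp
      have "(u i * w j) * (V i * V j) = (u i * V j) * (w j * V i)" by (simp add: mult_ac)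
      also have "\<dots> = (u j * V i) * (w i * V j)" by (simp only: uu ww)
      also have "\<dots> = (u j * w i) * (V i * V j)" by (simp add: mult_ac)
      finally have 1: "u i * w j = u j * w i" using nz by simp
      have "(v i * w j) * (V i * V j) = (v i * V j) * (w j * V i)" by (simp add: mult_ac)
      also have "\<dots> = (v j * V i) * (w i * V j)" by (simp only: vv ww)
      also have "\<dots> = (v j * w i) * (V i * V j)" by (simp add: mult_ac)
      finally have "v i * w j = v j * w i" using nz by simp
      with 1 npar[OF ij True] show False by simp
    next
      case False
      then have "u i * V j - u j * V i \<noteq> 0" using uV[of i j] by simp
      then have "\<mu> = ?bad (i, j)" using eq by (simp add: field_simps)
      with \<mu> ij show False by blast
    qed
  qed
  interpret plane_lines N a c
    by standard (use c_neq in \<open>auto simp: inj_on_def\<close>)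
  have meet_eq: "meet k j = meet k i \<longleftrightarrow> lin k j = lin k i"
    if "i < N" "j < N" "k < N" "cl i \<noteq> cl k" "cl j \<noteq> cl k" for i j k
  proof -
    have ne: "i \<noteq> k" "j \<noteq> k" using that by auto
    have nz: "c j - c k \<noteq> 0" "c i - c k \<noteq> 0" using c_neq that ne by auto
    have VV: "V i \<noteq> 0" "V j \<noteq> 0" "V k \<noteq> 0" using V that by auto
    have av: "a l * V l = u l" "c l * V l = w l + \<mu> * u l" if "l < N" for l
      using V[OF that] by (simp_all add: a_def c_def)
    have "meet k j = meet k i \<longleftrightarrow> (a k - a j) * (c i - c k) - (a k - a i) * (c j - c k) = 0"
      using nz by (simp add: meet_def field_simps)
    also have "\<dots> \<longleftrightarrow> ((a k - a j) * (c i - c k) - (a k - a i) * (c j - c k)) * (V i * V j * V k) = 0"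
      using VV by simp
    also have "((a k - a j) * (c i - c k) - (a k - a i) * (c j - c k)) * (V i * V j * V k)
       = a k * V k * (c i * V i * V j - c j * V j * V i)
         - a j * V j * (c i * V i * V k - c k * V k * V i)
         + a i * V i * (c j * V j * V k - c k * V k * V j)"
      by (simp add: algebra_simps)
    also have "\<dots> = u k * ((w i + \<mu> * u i) * V j - (w j + \<mu> * u j) * V i)
         - u j * ((w i + \<mu> * u i) * V k - (w k + \<mu> * u k) * V i)
         + u i * ((w j + \<mu> * u j) * V k - (w k + \<mu> * u k) * V j)"
      by (simp only: av that)
    \<comment> \<open>The change of coordinates by \<open>\<kappa>\<close> and \<open>\<mu>\<close>
      has determinant 1, so the original determinant reappears.\<close>
    also have "\<dots> = det3 (u k, v k, w k) (u j, v j, w j) (u i, v i, w i)"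
      by (simp add: det3_def V_def algebra_simps)
    finally show ?thesis using lin[OF that] by simp
  qed
  have "card (cl ` {..<N}) = card slopes"
    using a_eq by (intro card_image_eq_kernel) auto
  moreover have "card (lin k ` {j. j < k \<and> cl j \<noteq> cl k}) = card (meets k)" if "k < N" for k
  proof -
    have "meets k = meet k ` {j. j < k \<and> cl j \<noteq> cl k}"
      using a_eq that unfolding meets_def by (intro arg_cong[of _ _ "image (meet k)"]) auto
    then show ?thesis using meet_eq that by (auto intro!: card_image_eq_kernel)
  qed
  ultimately show ?thesis using planar_inequality by simp
qed

lemma infinite_UNIV_poly_fract: "infinite (UNIV :: 'k::field poly fract set)"
proof -
  have "inj (\<lambda>n. to_fract (monom (1::'k) n))"
    by (rule injI) (simp add: monom_eq_iff')
  then have "infinite (range (\<lambda>n. to_fract (monom (1::'k) n)))"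
    by (rule range_inj_infinite)
  then show ?thesis by (meson finite_subset subset_UNIV)
qed

text \<open>Passing to the infinite extension field \<open>'k poly fract\<close> makes room for a generic chart.\<close>

lemma triples_inequality:
  fixes u v w :: "nat \<Rightarrow> 'k::field" and cl :: "nat \<Rightarrow> 'c" and lin :: "nat \<Rightarrow> nat \<Rightarrow> 'l"
  assumes uv: "\<And>i. i < N \<Longrightarrow> u i \<noteq> 0 \<or> v i \<noteq> 0"
    and npar: "\<And>i j. i < N \<Longrightarrow> j < N \<Longrightarrow> i \<noteq> j \<Longrightarrow> u i * v j = u j * v i \<Longrightarrow>
      u i * w j \<noteq> u j * w i \<or> v i * w j \<noteq> v j * w i"
    and cl: "\<And>i j. i < N \<Longrightarrow> j < N \<Longrightarrow> cl i = cl j \<longleftrightarrow> u i * v j = u j * v i"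
    and lin: "\<And>i j k. i < N \<Longrightarrow> j < N \<Longrightarrow> k < N \<Longrightarrow> cl i \<noteq> cl k \<Longrightarrow> cl j \<noteq> cl k \<Longrightarrow>
      lin k j = lin k i \<longleftrightarrow> det3 (u k, v k, w k) (u j, v j, w j) (u i, v i, w i) = 0"
  shows "(card (cl ` {..<N}) - 1) * (N + 1 - card (cl ` {..<N}))
    \<le> (\<Sum>k<N. card (lin k ` {j. j < k \<and> cl j \<noteq> cl k}))"
proof -
  define \<iota> :: "'k \<Rightarrow> 'k poly fract" where "\<iota> x = to_fract [:x:]" for x
  have mult: "\<iota> x * \<iota> y = \<iota> (x * y)" for x y by (simp add: \<iota>_def flip: to_fract_mult)
  have add: "\<iota> x + \<iota> y = \<iota> (x + y)" for x y by (simp add: \<iota>_def flip: to_fract_add)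
  have diff: "\<iota> x - \<iota> y = \<iota> (x - y)" for x y by (simp add: \<iota>_def flip: to_fract_diff)
  have zero: "\<iota> x = 0 \<longleftrightarrow> x = 0" for x by (simp add: \<iota>_def)
  have eq: "\<iota> x = \<iota> y \<longleftrightarrow> x = y" for x y by (simp add: \<iota>_def)
  show ?thesis
  proof (rule triples_inequality_infinite[OF infinite_UNIV_poly_fract, where u = "\<iota> \<circ> u" and v = "\<iota> \<circ> v" and w = "\<iota> \<circ> w"])
    show "(\<iota> \<circ> u) i \<noteq> 0 \<or> (\<iota> \<circ> v) i \<noteq> 0" if "i < N" for i
      using uv[OF that] by (simp add: zero)
    show "(\<iota> \<circ> u) i * (\<iota> \<circ> w) j \<noteq> (\<iota> \<circ> u) j * (\<iota> \<circ> w) i \<or> (\<iota> \<circ> v) i * (\<iota> \<circ> w) j \<noteq> (\<iota> \<circ> v) j * (\<iota> \<circ> w) i"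
      if "i < N" "j < N" "i \<noteq> j" "(\<iota> \<circ> u) i * (\<iota> \<circ> v) j = (\<iota> \<circ> u) j * (\<iota> \<circ> v) i" for i j
      using npar[of i j] that by (simp add: mult eq)
    show "cl i = cl j \<longleftrightarrow> (\<iota> \<circ> u) i * (\<iota> \<circ> v) j = (\<iota> \<circ> u) j * (\<iota> \<circ> v) i" if "i < N" "j < N" for i j
      using cl[OF that] by (simp add: mult eq)
    show "lin k j = lin k i \<longleftrightarrow> det3 ((\<iota> \<circ> u) k, (\<iota> \<circ> v) k, (\<iota> \<circ> w) k) ((\<iota> \<circ> u) j, (\<iota> \<circ> v) j, (\<iota> \<circ> w) j)
        ((\<iota> \<circ> u) i, (\<iota> \<circ> v) i, (\<iota> \<circ> w) i) = 0"
      if "i < N" "j < N" "k < N" "cl i \<noteq> cl k" "cl j \<noteq> cl k" for i j k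
      using lin[OF that] by (simp add: det3_def mult add diff zero)
  qed
qed

text \<open>In the enumeration \<open>h\<close>, a block is counted at each of its elements except
  the first.\<close>

lemma sum_card_less_one_eq_later_elements:
  fixes h :: "nat \<Rightarrow> 'i"
  assumes inj: "inj_on h {..<N}" and fin: "finite \<B>"
    and B: "\<And>B. B \<in> \<B> \<Longrightarrow> B \<subseteq> h ` {..<N} \<and> B \<noteq> {}"
  shows "(\<Sum>B\<in>\<B>. card B - 1) = (\<Sum>k<N. card {B \<in> \<B>. h k \<in> B \<and> (\<exists>j<k. h j \<in> B)})"
proof -
  have "card B - 1 = (\<Sum>k<N. if h k \<in> B \<and> (\<exists>j<k. h j \<in> B) then 1 else 0)" if "B \<in> \<B>" for B
  proof -
    let ?K = "{k. k < N \<and> h k \<in> B}"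
    have "bij_betw h ?K B"
      using B[OF that] inj by (auto simp: bij_betw_def inj_on_def)
    then have card: "card ?K = card B" by (rule bij_betw_same_card)
    have "?K \<noteq> {}" using B[OF that] by auto
    then have Min: "Min ?K \<in> ?K" by (intro Min_in) auto
    have "{k \<in> {..<N}. h k \<in> B \<and> (\<exists>j<k. h j \<in> B)} = ?K - {Min ?K}"
    proof (intro equalityI subsetI)
      fix k assume "k \<in> {k \<in> {..<N}. h k \<in> B \<and> (\<exists>j<k. h j \<in> B)}"
      then obtain j where "k < N" "h k \<in> B" "j < k" "h j \<in> B" by auto
      moreover from this have "Min ?K \<le> j" by (intro Min_le) auto
      ultimately have "k \<noteq> Min ?K" by linarith
      with \<open>k < N\<close> \<open>h k \<in> B\<close> show "k \<in> ?K - {Min ?K}" by blast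
    next
      fix k assume k: "k \<in> ?K - {Min ?K}"
      then have "Min ?K < k" using Min_le[of ?K k] by fastforce
      with k Min show "k \<in> {k \<in> {..<N}. h k \<in> B \<and> (\<exists>j<k. h j \<in> B)}" by blast
    qed
    then have "card {k \<in> {..<N}. h k \<in> B \<and> (\<exists>j<k. h j \<in> B)} = card B - 1"
      using Min card by (simp add: card_Diff_singleton)
    then show ?thesis by (simp flip: sum.inter_filter)
  qed
  then have "(\<Sum>B\<in>\<B>. card B - 1) = (\<Sum>B\<in>\<B>. \<Sum>k<N. if h k \<in> B \<and> (\<exists>j<k. h j \<in> B) then 1 else 0)"
    by simp
  also have "\<dots> = (\<Sum>k<N. \<Sum>B\<in>\<B>. if h k \<in> B \<and> (\<exists>j<k. h j \<in> B) then 1 else 0)"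
    by (rule sum.swap)
  also have "\<dots> = (\<Sum>k<N. card {B \<in> \<B>. h k \<in> B \<and> (\<exists>j<k. h j \<in> B)})"
    using fin by (intro sum.cong refl) (simp flip: sum.inter_filter)
  finally show ?thesis .
qed

lemma span_eq_if_independent_card:
  fixes A B :: "('k::field ^ 'm) set"
  assumes "vec.independent B" "B \<subseteq> vec.span A" "finite A" "card A \<le> card B"
  shows "vec.span B = vec.span A"
proof
  show "vec.span B \<subseteq> vec.span A" by (rule vec.span_minimal[OF assms(2) vec.subspace_span])
  have "vec.dim (vec.span A) \<le> card B"
    using vec.dim_le_card'[OF assms(3)] assms(4) by simp
  then show "vec.span A \<subseteq> vec.span B"
    by (rule vec.card_ge_dim_independent[OF assms(2,1)])
qed

lemma independent_pair: "x \<noteq> 0 \<Longrightarrow> y \<notin> vec.span {x} \<Longrightarrow> vec.independent {y, x}"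
  by (simp add: vec.independent_insert)

lemma independent_triple:
  "x \<noteq> 0 \<Longrightarrow> y \<notin> vec.span {x} \<Longrightarrow> z \<notin> vec.span {y, x} \<Longrightarrow> vec.independent {z, y, x}"
  by (simp add: vec.independent_insert)

lemma mem_span_pair: "x \<in> vec.span {y, z} \<longleftrightarrow> (\<exists>\<alpha> \<beta>. x = \<alpha> *s y + \<beta> *s z)"
proof -
  have "x \<in> vec.span {y, z} \<longleftrightarrow> (\<exists>\<alpha> \<beta>. x - \<alpha> *s y = \<beta> *s z)"
    by (auto simp: vec.span_breakdown_eq[of x y "{z}"] vec.span_singleton)
  then show ?thesis by (simp add: algebra_simps)
qed

lemma mem_span_triple: "x \<in> vec.span {y, z, w} \<longleftrightarrow> (\<exists>\<alpha> \<beta> \<gamma>. x = \<alpha> *s y + \<beta> *s z + \<gamma> *s w)"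
proof -
  have "x \<in> vec.span {y, z, w} \<longleftrightarrow> (\<exists>\<alpha> \<beta> \<gamma>. x - \<alpha> *s y = \<beta> *s z + \<gamma> *s w)"
    by (simp add: vec.span_breakdown_eq[of x y "{z, w}"] mem_span_pair)
  then show ?thesis by (simp add: algebra_simps)
qed

section \<open>Projecting a finite set of points\<close>

locale projected_points =
  fixes E :: "'i set" and g :: "'i \<Rightarrow> 'k::field ^ 'm" and w :: "'k ^ 'm"
  assumes finite_E: "finite E"
    and w_nonzero: "w \<noteq> 0"
    and not_w: "e \<in> E \<Longrightarrow> g e \<notin> vec.span {w}"
    and distinct: "e \<in> E \<Longrightarrow> f \<in> E \<Longrightarrow> e \<noteq> f \<Longrightarrow> g e \<notin> vec.span {g f}"
begin

text \<open>This is the fibre of the projection from \<open>w\<close>. Flats are recorded as index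
  sets of the points in them, so that they can be counted and compared directly.\<close>

definition cls :: "'i \<Rightarrow> 'i set" where "cls e = {f \<in> E. g f \<in> vec.span {g e, w}}"
definition line :: "'i \<Rightarrow> 'i \<Rightarrow> 'i set" where "line e f = {h \<in> E. g h \<in> vec.span {g e, g f}}"
definition plane :: "'i \<Rightarrow> 'i \<Rightarrow> 'i set" where "plane e f = {h \<in> E. g h \<in> vec.span {g e, g f, w}}"

lemma g_nonzero: "e \<in> E \<Longrightarrow> g e \<noteq> 0"
  using not_w[of e] vec.span_zero[of "{w}"] by auto

lemma in_cls_self: "e \<in> E \<Longrightarrow> e \<in> cls e"
  by (simp add: cls_def vec.span_base)

lemma cls_subset: "cls e \<subseteq> E" and line_subset: "line e f \<subseteq> E" and plane_subset: "plane e f \<subseteq> E"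
  by (auto simp: cls_def line_def plane_def)

lemma in_line: "e \<in> E \<Longrightarrow> f \<in> E \<Longrightarrow> e \<in> line e f \<and> f \<in> line e f"
  by (simp add: line_def vec.span_base)

lemma in_plane: "e \<in> E \<Longrightarrow> f \<in> E \<Longrightarrow> e \<in> plane e f \<and> f \<in> plane e f"
  by (simp add: plane_def vec.span_base)

lemma cls_eq_iff: "e \<in> E \<Longrightarrow> f \<in> E \<Longrightarrow> cls e = cls f \<longleftrightarrow> g e \<in> vec.span {g f, w}"
proof
  assume ef: "e \<in> E" "f \<in> E" and "g e \<in> vec.span {g f, w}"
  then have "vec.span {g e, w} = vec.span {g f, w}"
    using not_w[of e] w_nonzero
    by (intro span_eq_if_independent_card independent_pair) (auto simp: vec.span_base card_insert_if)
  then show "cls e = cls f" by (simp add: cls_def)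
qed (use in_cls_self in \<open>auto simp: cls_def\<close>)

lemma in_cls_iff: "e \<in> E \<Longrightarrow> f \<in> cls e \<longleftrightarrow> f \<in> E \<and> cls f = cls e"
  using cls_eq_iff by (auto simp: cls_def)

lemma span_line:
  assumes "e \<in> E" "f \<in> E" "h \<in> line e f" "h' \<in> line e f" "h \<noteq> h'"
  shows "vec.span {g h, g h'} = vec.span {g e, g f}"
proof (rule span_eq_if_independent_card)
  have hE: "h \<in> E" "h' \<in> E" using assms by (auto simp: line_def)
  show "vec.independent {g h, g h'}"
    using distinct[OF hE] g_nonzero hE assms by (intro independent_pair) auto
  have "g h \<noteq> g h'" using distinct[OF hE assms(5)] by (auto simp: vec.span_base)
  then show "card {g e, g f} \<le> card {g h, g h'}" by (simp add: card_insert_if)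
  show "{g h, g h'} \<subseteq> vec.span {g e, g f}" using assms(3,4) unfolding line_def by blast
qed simp

lemma line_eq:
  "e \<in> E \<Longrightarrow> f \<in> E \<Longrightarrow> h \<in> line e f \<Longrightarrow> h' \<in> line e f \<Longrightarrow> h \<noteq> h' \<Longrightarrow> line h h' = line e f"
  by (drule (4) span_line) (simp only: line_def)

lemma span_plane:
  assumes "e \<in> E" "f \<in> E" "h \<in> plane e f" "h' \<in> plane e f" "cls h \<noteq> cls h'"
  shows "vec.span {g h, g h', w} = vec.span {g e, g f, w}"
proof (rule span_eq_if_independent_card)
  have hE: "h \<in> E" "h' \<in> E" using assms by (auto simp: plane_def)
  have *: "g h \<notin> vec.span {g h', w}" "g h' \<notin> vec.span {w}"
    using hE assms(5) cls_eq_iff not_w by auto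
  then show "vec.independent {g h, g h', w}" by (intro independent_triple w_nonzero)
  have "g h \<noteq> g h'" "g h \<noteq> w" "g h' \<noteq> w" using * by (auto simp: vec.span_base)
  then show "card {g e, g f, w} \<le> card {g h, g h', w}" by (simp add: card_insert_if)
  show "{g h, g h', w} \<subseteq> vec.span {g e, g f, w}"
    using assms(3,4) vec.span_base[of w "{g e, g f, w}"] unfolding plane_def by blast
qed simp

lemma plane_eq:
  "e \<in> E \<Longrightarrow> f \<in> E \<Longrightarrow> h \<in> plane e f \<Longrightarrow> h' \<in> plane e f \<Longrightarrow> cls h \<noteq> cls h' \<Longrightarrow> plane h h' = plane e f"
  by (drule (4) span_plane) (simp only: plane_def)

lemma cls_subset_plane: "e \<in> E \<Longrightarrow> f \<in> E \<Longrightarrow> h \<in> plane e f \<Longrightarrow> cls h \<subseteq> plane e f"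
proof
  fix x assume *: "e \<in> E" "f \<in> E" "h \<in> plane e f" "x \<in> cls h"
  then have "{g h, w} \<subseteq> vec.span {g e, g f, w}" by (auto simp: plane_def vec.span_base)
  then have "vec.span {g h, w} \<subseteq> vec.span {g e, g f, w}"
    by (rule vec.span_minimal) simp
  then show "x \<in> plane e f" using * by (auto simp: plane_def cls_def)
qed

lemma line_subset_plane: "e \<in> E \<Longrightarrow> f \<in> E \<Longrightarrow> line e f \<subseteq> plane e f"
  unfolding line_def plane_def using vec.span_mono[of "{g e, g f}" "{g e, g f, w}"] by auto

text \<open>A line with two points in one fibre contains \<open>w\<close>, and then all its points
  lie in that fibre.\<close>

lemma cls_neq_on_line:
  assumes "e \<in> E" "f \<in> E" "cls e \<noteq> cls f" "h \<in> line e f" "h' \<in> line e f" "h \<noteq> h'"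
  shows "cls h \<noteq> cls h'"
proof
  assume "cls h = cls h'"
  have hE: "h \<in> E" "h' \<in> E" using assms by (auto simp: line_def)
  have "g h \<in> vec.span (insert w {g h'})"
    using \<open>cls h = cls h'\<close> cls_eq_iff hE by (simp add: insert_commute)
  then have "w \<in> vec.span {g h, g h'}"
    using distinct[OF hE assms(6)] by (rule vec.in_span_insert)
  then have "w \<in> vec.span (insert (g e) {g f})"
    using span_line assms by simp
  moreover have "w \<notin> vec.span {g f}"
  proof
    assume "w \<in> vec.span {g f}"
    then obtain t where t: "w = t *s g f" by (auto simp: vec.span_singleton)
    then have "g f = (1 / t) *s w" using w_nonzero by (auto simp: vec.scale_scale)
    then show False using not_w[OF assms(2)] by (auto simp: vec.span_singleton)
  qed
  ultimately have "g e \<in> vec.span {w, g f}" by (rule vec.in_span_insert)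
  then show False using cls_eq_iff assms by (simp add: insert_commute)
qed

section \<open>Coordinates in a plane through \<open>w\<close>\<close>

definition coord_of :: "'i \<Rightarrow> 'i \<Rightarrow> 'i \<Rightarrow> 'k \<times> 'k \<times> 'k" where
  "coord_of e f h = (SOME p. g h = fst p *s g e + fst (snd p) *s g f + snd (snd p) *s w)"

definition coord1 :: "'i \<Rightarrow> 'i \<Rightarrow> 'i \<Rightarrow> 'k" where "coord1 e f h = fst (coord_of e f h)"
definition coord2 :: "'i \<Rightarrow> 'i \<Rightarrow> 'i \<Rightarrow> 'k" where "coord2 e f h = fst (snd (coord_of e f h))"
definition coord3 :: "'i \<Rightarrow> 'i \<Rightarrow> 'i \<Rightarrow> 'k" where "coord3 e f h = snd (snd (coord_of e f h))"

context
  fixes e f assumes ef: "e \<in> E" "f \<in> E" "cls e \<noteq> cls f"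
begin

abbreviation (input) "U h \<equiv> coord1 e f h"
abbreviation (input) "V h \<equiv> coord2 e f h"
abbreviation (input) "T h \<equiv> coord3 e f h"

lemma coords: "h \<in> plane e f \<Longrightarrow> g h = U h *s g e + V h *s g f + T h *s w"
proof -
  assume "h \<in> plane e f"
  then obtain \<alpha> \<beta> \<gamma> where "g h = \<alpha> *s g e + \<beta> *s g f + \<gamma> *s w" by (auto simp: plane_def mem_span_triple)
  then show ?thesis unfolding coord1_def coord2_def coord3_def coord_of_def
    by (intro someI[of "\<lambda>p. g h = fst p *s g e + fst (snd p) *s g f + snd (snd p) *s w" "(\<alpha>, \<beta>, \<gamma>)"]) simp
qed

lemma coords_independent:
  assumes "x *s g e + y *s g f + z *s w = 0"
  shows "x = 0 \<and> y = 0 \<and> z = 0"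
proof -
  have x: "x = 0"
  proof (rule ccontr)
    assume x: "x \<noteq> 0"
    have "x *s g e = (- y) *s g f + (- z) *s w" using assms by (simp add: vec_eq_iff algebra_simps eq_neg_iff_add_eq_0)
    then have "(1 / x) *s (x *s g e) = (1 / x) *s ((- y) *s g f + (- z) *s w)" by simp
    then have "g e = (- y / x) *s g f + (- z / x) *s w"
      using x by (simp add: vec.scale_right_distrib)
    then have "g e \<in> vec.span {g f, w}" using mem_span_pair by blast
    then show False using ef cls_eq_iff by simp
  qed
  have y: "y = 0"
  proof (rule ccontr)
    assume y: "y \<noteq> 0"
    have "y *s g f = (- z) *s w" using assms x by (simp add: vec_eq_iff algebra_simps eq_neg_iff_add_eq_0)
    then have "(1 / y) *s (y *s g f) = (1 / y) *s ((- z) *s w)" by simp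
    then have "g f = (- z / y) *s w" using y by simp
    then have "g f \<in> vec.span {w}" by (simp only:) (intro vec.span_scale vec.span_base singletonI)
    then show False using not_w[OF ef(2)] by simp
  qed
  show ?thesis using assms x y w_nonzero by simp
qed

lemma coords_unique:
  assumes "x *s g e + y *s g f + z *s w = x' *s g e + y' *s g f + z' *s w"
  shows "x = x' \<and> y = y' \<and> z = z'"
proof -
  have "(x - x') *s g e + (y - y') *s g f + (z - z') *s w = 0"
    using assms by (simp add: vec.scale_left_diff_distrib algebra_simps)
  then show ?thesis using coords_independent[of "x - x'" "y - y'" "z - z'"] by simp
qed

lemma UV_nonzero: "h \<in> plane e f \<Longrightarrow> U h \<noteq> 0 \<or> V h \<noteq> 0"
  using coords[of h] not_w[of h] by (auto simp: plane_def vec.span_singleton)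

text \<open>Serves two purposes: proportional first two coordinates mean a common fibre, and the
  extra premises on \<open>T\<close> mean a common projective point, which distinctness forbids for
  different indices.\<close>

lemma proportional:
  assumes "i \<in> plane e f" "j \<in> plane e f" "U i * V j = U j * V i"
  obtains t where "U i = t * U j" "V i = t * V j"
    "U i * T j = U j * T i \<Longrightarrow> V i * T j = V j * T i \<Longrightarrow> T i = t * T j"
proof (cases "U j = 0")
  case True
  then have "V j \<noteq> 0" using UV_nonzero assms(2) by auto
  with True assms(3) show ?thesis by (intro that[of "V i / V j"]) (auto simp: field_simps)
next
  case False
  with assms(3) show ?thesis by (intro that[of "U i / U j"]) (auto simp: field_simps)
qed

text \<open>The third coordinate runs along \<open>w\<close>, so projection from \<open>w\<close>
  keeps just the ratio of the first two.\<close>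

lemma cls_eq_iff_coords:
  assumes "i \<in> plane e f" "j \<in> plane e f"
  shows "cls i = cls j \<longleftrightarrow> U i * V j = U j * V i"
proof
  have ij: "i \<in> E" "j \<in> E" using assms plane_subset by auto
  {
    assume "cls i = cls j"
    then obtain \<alpha> \<beta> where "g i = \<alpha> *s g j + \<beta> *s w" using ij cls_eq_iff mem_span_pair by blast
    also have "\<dots> = (\<alpha> * U j) *s g e + (\<alpha> * V j) *s g f + (\<alpha> * T j + \<beta>) *s w"
      by (subst coords[OF assms(2)]) (simp add: vec.scale_right_distrib vec.scale_left_distrib)
    finally have "U i = \<alpha> * U j \<and> V i = \<alpha> * V j"
      using coords_unique coords[OF assms(1)] by metis
    then show "U i * V j = U j * V i" by simp
  next
    assume "U i * V j = U j * V i"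
    then obtain t where t: "U i = t * U j" "V i = t * V j" using proportional[OF assms] by metis
    have "g i = t *s g j + (T i - t * T j) *s w"
      by (subst coords[OF assms(1)], subst coords[OF assms(2)])
         (simp add: t vec.scale_right_distrib vec.scale_left_diff_distrib)
    then show "cls i = cls j" using ij cls_eq_iff mem_span_pair by blast
  }
qed

lemma in_line_iff_det:
  assumes "i \<in> plane e f" "j \<in> plane e f" "k \<in> plane e f" "cls j \<noteq> cls k"
  shows "i \<in> line k j \<longleftrightarrow> det3 (U k, V k, T k) (U j, V j, T j) (U i, V i, T i) = 0"
proof
  assume "i \<in> line k j"
  then obtain \<alpha> \<beta> where "g i = \<alpha> *s g k + \<beta> *s g j" by (auto simp: line_def mem_span_pair)
  also have "\<dots> = (\<alpha> * U k + \<beta> * U j) *s g e + (\<alpha> * V k + \<beta> * V j) *s g f + (\<alpha> * T k + \<beta> * T j) *s w"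
    by (subst coords[OF assms(2)], subst coords[OF assms(3)])
       (simp add: vec.scale_right_distrib vec.scale_left_distrib)
  finally have "U i = \<alpha> * U k + \<beta> * U j \<and> V i = \<alpha> * V k + \<beta> * V j \<and> T i = \<alpha> * T k + \<beta> * T j"
    using coords_unique coords[OF assms(1)] by metis
  then show "det3 (U k, V k, T k) (U j, V j, T j) (U i, V i, T i) = 0"
    by (simp add: det3_def algebra_simps)
next
  assume det: "det3 (U k, V k, T k) (U j, V j, T j) (U i, V i, T i) = 0"
  define D where "D = U k * V j - U j * V k"
  have D: "D \<noteq> 0" using cls_eq_iff_coords[OF assms(2,3)] assms(4) by (simp add: D_def)
  \<comment> \<open>Cramer's rule for the first two coordinates; the third then fails by
    \<open>det3 / D\<close>, which is zero.\<close>
  define \<alpha> where "\<alpha> = (U i * V j - U j * V i) / D"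
  define \<beta> where "\<beta> = (U k * V i - U i * V k) / D"
  have *: "D * U i = (U i * V j - U j * V i) * U k + (U k * V i - U i * V k) * U j"
    and **: "D * V i = (U i * V j - U j * V i) * V k + (U k * V i - U i * V k) * V j"
    and ***: "D * T i = (U i * V j - U j * V i) * T k + (U k * V i - U i * V k) * T j
       + det3 (U k, V k, T k) (U j, V j, T j) (U i, V i, T i)"
    by (simp_all add: D_def det3_def algebra_simps)
  have quot: "x = \<alpha> * y + \<beta> * z" if "D * x = (U i * V j - U j * V i) * y + (U k * V i - U i * V k) * z" for x y z
  proof -
    have "D * x = D * (\<alpha> * y + \<beta> * z)" using D that by (simp add: \<alpha>_def \<beta>_def distrib_left)
    then show ?thesis using D by simp
  qed
  have ab: "U i = \<alpha> * U k + \<beta> * U j" "V i = \<alpha> * V k + \<beta> * V j" "T i = \<alpha> * T k + \<beta> * T j"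
    using *** det by (simp_all only: quot[OF *] quot[OF **] quot add_0_right)
  have "g i = \<alpha> *s g k + \<beta> *s g j"
    by (subst coords[OF assms(1)], subst coords[OF assms(2)], subst coords[OF assms(3)])
       (simp add: ab vec.scale_right_distrib vec.scale_left_distrib)
  then have "g i \<in> vec.span {g k, g j}" using mem_span_pair by blast
  then show "i \<in> line k j" using assms(1) plane_subset[of e f] unfolding line_def by blast
qed

lemma line_eq_iff:
  assumes "i \<in> E" "j \<in> E" "k \<in> E" "i \<noteq> k" "j \<noteq> k"
  shows "line k j = line k i \<longleftrightarrow> i \<in> line k j"
proof
  assume "line k j = line k i"
  then show "i \<in> line k j" using in_line[of k i] assms by blast
next
  assume "i \<in> line k j"
  then have "line k i = line k j" using line_eq[of k j k i] in_line[of k j] assms by blast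
  then show "line k j = line k i" by (rule sym)
qed

text \<open>With the plane enumerated, term \<open>k\<close> of \<open>triples_inequality\<close>
  counts the lines that join point \<open>k\<close> to an earlier point of another fibre. Over all
  \<open>k\<close>, a line is counted once for each of its points but the first.\<close>

lemma plane_inequality:
  "(card (cls ` plane e f) - 1) * (card (plane e f) + 1 - card (cls ` plane e f))
     \<le> (\<Sum>B\<in>{line x y |x y. x \<in> plane e f \<and> y \<in> plane e f \<and> cls x \<noteq> cls y}. card B - 1)"
proof -
  define Y where "Y = plane e f"
  define \<B> where "\<B> = {line x y |x y. x \<in> Y \<and> y \<in> Y \<and> cls x \<noteq> cls y}"
  define N where "N = card Y"
  have YE: "Y \<subseteq> E" unfolding Y_def by (rule plane_subset)
  have finY: "finite Y" using YE finite_E by (rule finite_subset)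
  obtain h where h: "bij_betw h {0..<N} Y"
    using ex_bij_betw_nat_finite[OF finY] by (auto simp: N_def)
  then have hY: "h ` {..<N} = Y" and inj: "inj_on h {..<N}"
    by (auto simp: bij_betw_def atLeast0LessThan)
  have hin: "h i \<in> Y" "h i \<in> E" if "i < N" for i using hY YE that by auto
  have hne: "h i \<noteq> h j" if "i < N" "j < N" "i \<noteq> j" for i j using inj that by (auto simp: inj_on_def)
  have "(card ((cls \<circ> h) ` {..<N}) - 1) * (N + 1 - card ((cls \<circ> h) ` {..<N}))
    \<le> (\<Sum>k<N. card ((\<lambda>j. line (h k) (h j)) ` {j. j < k \<and> (cls \<circ> h) j \<noteq> (cls \<circ> h) k}))"
  proof (rule triples_inequality[where u = "\<lambda>i. U (h i)" and v = "\<lambda>i. V (h i)" and w = "\<lambda>i. T (h i)"])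
    show "U (h i) \<noteq> 0 \<or> V (h i) \<noteq> 0" if "i < N" for i
      using UV_nonzero hin[OF that] by (simp add: Y_def)
    show "(cls \<circ> h) i = (cls \<circ> h) j \<longleftrightarrow> U (h i) * V (h j) = U (h j) * V (h i)" if "i < N" "j < N" for i j
      using cls_eq_iff_coords hin that by (simp add: Y_def)
    show "U (h i) * T (h j) \<noteq> U (h j) * T (h i) \<or> V (h i) * T (h j) \<noteq> V (h j) * T (h i)"
      if ij: "i < N" "j < N" "i \<noteq> j" and par: "U (h i) * V (h j) = U (h j) * V (h i)" for i j
    proof (rule ccontr)
      assume "\<not> ?thesis"
      moreover have pl: "h i \<in> plane e f" "h j \<in> plane e f" using hin ij by (auto simp: Y_def)
      ultimately obtain t where t: "U (h i) = t * U (h j)" "V (h i) = t * V (h j)" "T (h i) = t * T (h j)"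
        using proportional[OF pl par] by metis
      have "g (h i) = t *s g (h j)"
        by (subst coords[OF pl(1)], subst coords[OF pl(2)]) (simp add: t vec.scale_right_distrib)
      then have "g (h i) \<in> vec.span {g (h j)}" by (auto simp: vec.span_singleton)
      then show False using distinct hin hne ij by blast
    qed
    show "line (h k) (h j) = line (h k) (h i) \<longleftrightarrow>
        det3 (U (h k), V (h k), T (h k)) (U (h j), V (h j), T (h j)) (U (h i), V (h i), T (h i)) = 0"
      if "i < N" "j < N" "k < N" "(cls \<circ> h) i \<noteq> (cls \<circ> h) k" "(cls \<circ> h) j \<noteq> (cls \<circ> h) k" for i j k
    proof -
      have "h i \<noteq> h k" "h j \<noteq> h k" "cls (h j) \<noteq> cls (h k)" using that by auto
      then show ?thesis
        using line_eq_iff[of "h i" "h j" "h k"] in_line_iff_det[of "h i" "h j" "h k"] hin that(1-3)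
        by (simp add: Y_def)
    qed
  qed
  also have "(cls \<circ> h) ` {..<N} = cls ` Y" by (metis hY image_comp)
  also have "(\<Sum>k<N. card ((\<lambda>j. line (h k) (h j)) ` {j. j < k \<and> (cls \<circ> h) j \<noteq> (cls \<circ> h) k}))
     = (\<Sum>k<N. card {B \<in> \<B>. h k \<in> B \<and> (\<exists>j<k. h j \<in> B)})"
  proof (intro sum.cong refl arg_cong[of _ _ card] equalityI subsetI)
    fix k B assume "k \<in> {..<N}" and "B \<in> (\<lambda>j. line (h k) (h j)) ` {j. j < k \<and> (cls \<circ> h) j \<noteq> (cls \<circ> h) k}"
    then obtain j where j: "k < N" "j < k" "cls (h j) \<noteq> cls (h k)" "B = line (h k) (h j)" by auto
    moreover have "h k \<in> Y" "h j \<in> Y" using hin j by auto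
    moreover from this have "h k \<in> B" "h j \<in> B" using in_line YE j by auto
    moreover from this have "B \<in> \<B>"
      unfolding \<B>_def mem_Collect_eq using j \<open>h k \<in> Y\<close> \<open>h j \<in> Y\<close>
      by (intro exI[of _ "h k"] exI[of _ "h j"]) simp
    ultimately show "B \<in> {B \<in> \<B>. h k \<in> B \<and> (\<exists>j<k. h j \<in> B)}"
      using \<open>j < k\<close> by blast
  next
    fix k B assume k: "k \<in> {..<N}" and "B \<in> {B \<in> \<B>. h k \<in> B \<and> (\<exists>j<k. h j \<in> B)}"
    then obtain x y j where xy: "B = line x y" "x \<in> Y" "y \<in> Y" "cls x \<noteq> cls y" "h k \<in> B" "j < k" "h j \<in> B"
      by (auto simp: \<B>_def)
    have ne: "h k \<noteq> h j" using hne k xy by auto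
    have E: "x \<in> E" "y \<in> E" using xy YE by auto
    have "line (h k) (h j) = B" using line_eq[OF E _ _ ne] xy by simp
    moreover have "cls (h k) \<noteq> cls (h j)" using cls_neq_on_line[OF E xy(4) _ _ ne] xy by simp
    ultimately show "B \<in> (\<lambda>j. line (h k) (h j)) ` {j. j < k \<and> (cls \<circ> h) j \<noteq> (cls \<circ> h) k}"
      using xy(6) by (auto intro!: image_eqI[of _ _ j])
  qed
  also have "\<dots> = (\<Sum>B\<in>\<B>. card B - 1)"
  proof (rule sum_card_less_one_eq_later_elements[OF inj, symmetric])
    have "\<B> \<subseteq> (\<lambda>(x, y). line x y) ` (Y \<times> Y)" by (auto simp: \<B>_def)
    then show "finite \<B>" by (rule finite_subset) (use finY in simp)
    fix B assume "B \<in> \<B>"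
    then obtain x y where xy: "B = line x y" "x \<in> Y" "y \<in> Y" "cls x \<noteq> cls y" by (auto simp: \<B>_def)
    then have "B \<subseteq> plane x y" "B \<noteq> {}" using line_subset_plane in_line YE by blast+
    moreover have "plane x y = Y" using plane_eq[OF ef(1,2)] xy by (simp add: Y_def)
    ultimately show "B \<subseteq> h ` {..<N} \<and> B \<noteq> {}" by (simp add: hY)
  qed
  finally show ?thesis by (simp only: N_def Y_def \<B>_def)
qed

end

end

section \<open>Summation over all planes through \<open>w\<close>\<close>

lemma sum_blocks_through_point:
  assumes "finite E" "finite \<B>" "\<And>B. B \<in> \<B> \<Longrightarrow> B \<subseteq> E" "e \<in> E"
    and unique: "\<And>f. f \<in> E \<Longrightarrow> f \<noteq> e \<Longrightarrow> \<exists>!B. B \<in> \<B> \<and> e \<in> B \<and> f \<in> B"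
  shows "(\<Sum>B\<in>{B \<in> \<B>. e \<in> B}. card B - 1) = card E - 1"
proof -
  have fin: "finite B" if "B \<in> \<B>" for B using assms(1) assms(3)[OF that] by (rule rev_finite_subset)
  have "(\<Sum>B\<in>{B \<in> \<B>. e \<in> B}. card B - 1) = (\<Sum>B\<in>{B \<in> \<B>. e \<in> B}. card (B - {e}))"
    by (intro sum.cong) (auto simp: card_Diff_singleton)
  \<comment> \<open>Any other point lies on exactly one block with \<open>e\<close>, so the blocks
    through \<open>e\<close> partition the other points.\<close>
  also have "\<dots> = card (\<Union>B\<in>{B \<in> \<B>. e \<in> B}. B - {e})"
  proof (rule card_UN_disjoint[symmetric])
    show "\<forall>B\<in>{B \<in> \<B>. e \<in> B}. \<forall>C\<in>{B \<in> \<B>. e \<in> B}. B \<noteq> C \<longrightarrow> (B - {e}) \<inter> (C - {e}) = {}"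
    proof (intro ballI impI)
      fix B C assume BC: "B \<in> {B \<in> \<B>. e \<in> B}" "C \<in> {B \<in> \<B>. e \<in> B}" "B \<noteq> C"
      show "(B - {e}) \<inter> (C - {e}) = {}"
      proof (rule ccontr)
        assume "\<not> ?thesis"
        then obtain f where "f \<in> B" "f \<in> C" "f \<noteq> e" by auto
        moreover have "f \<in> E" using \<open>f \<in> B\<close> BC(1) assms(3) by auto
        ultimately show False using unique[of f] BC by auto
      qed
    qed
  qed (use assms(2) fin in auto)
  also have "(\<Union>B\<in>{B \<in> \<B>. e \<in> B}. B - {e}) = E - {e}"
  proof (intro equalityI subsetI)
    fix f assume "f \<in> E - {e}"
    then obtain B where "B \<in> \<B>" "e \<in> B" "f \<in> B" using unique[of f] by auto
    with \<open>f \<in> E - {e}\<close> show "f \<in> (\<Union>B\<in>{B \<in> \<B>. e \<in> B}. B - {e})" by auto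
  qed (use assms(3) in auto)
  finally show ?thesis using assms(1,4) by (simp add: card_Diff_singleton)
qed

context projected_points
begin

definition "classes = cls ` E"
definition "lines = {line e f |e f. e \<in> E \<and> f \<in> E \<and> e \<noteq> f}"
text \<open>A plane is stored as its set of fibres, that is, as a line of the projected
  configuration. So \<open>planes\<close> relates to \<open>classes\<close> as \<open>lines\<close>
  does to \<open>E\<close>, and one counting lemma serves both.\<close>

definition "planes = {cls ` plane e f |e f. e \<in> E \<and> f \<in> E \<and> cls e \<noteq> cls f}"

lemma finite_classes [simp]: "finite classes"
  and finite_lines [simp]: "finite lines"
  and finite_planes [simp]: "finite planes"
proof -
  show "finite classes" using finite_E by (simp add: classes_def)
  have "lines \<subseteq> (\<lambda>(e, f). line e f) ` (E \<times> E)" by (auto simp: lines_def)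
  then show "finite lines" by (rule finite_subset) (use finite_E in simp)
  have "planes \<subseteq> (\<lambda>(e, f). cls ` plane e f) ` (E \<times> E)" by (auto simp: planes_def)
  then show "finite planes" by (rule finite_subset) (use finite_E in simp)
qed

lemma finite_class: "Z \<in> classes \<Longrightarrow> finite Z"
  using finite_E cls_subset by (auto simp: classes_def intro: finite_subset)

lemma class_nonempty: "Z \<in> classes \<Longrightarrow> card Z \<ge> 1"
  using finite_class[of Z] in_cls_self by (auto simp: classes_def Suc_le_eq card_gt_0_iff)

lemma classes_disjoint: "Z \<in> classes \<Longrightarrow> Z' \<in> classes \<Longrightarrow> Z \<noteq> Z' \<Longrightarrow> Z \<inter> Z' = {}"
  using in_cls_iff by (fastforce simp: classes_def)

lemma plane_subset_classes: "Y \<in> planes \<Longrightarrow> Y \<subseteq> classes"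
  using plane_subset by (fastforce simp: planes_def classes_def)

lemma Union_plane: "e \<in> E \<Longrightarrow> f \<in> E \<Longrightarrow> \<Union>(cls ` plane e f) = plane e f"
proof (intro equalityI subsetI)
  fix h assume "h \<in> plane e f"
  then have "h \<in> cls h" using in_cls_self plane_subset by blast
  with \<open>h \<in> plane e f\<close> show "h \<in> \<Union>(cls ` plane e f)" by blast
qed (use cls_subset_plane[of e f] in blast)

lemma card_Union_classes: "Y \<subseteq> classes \<Longrightarrow> card (\<Union>Y) = (\<Sum>Z\<in>Y. card Z)"
proof (rule card_Union_disjoint)
  assume "Y \<subseteq> classes"
  then show "pairwise disjnt Y" unfolding pairwise_def disjnt_def by (meson classes_disjoint subsetD)
qed (use finite_class in blast)

lemma sum_card_classes_minus_one:
  assumes "Y \<subseteq> classes"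
  shows "(\<Sum>Z\<in>Y. card Z - 1) + card Y = card (\<Union>Y)"
proof -
  have "(\<Sum>Z\<in>Y. card Z - 1) + card Y = (\<Sum>Z\<in>Y. (card Z - 1) + 1)" by (simp only: sum.distrib) simp
  also have "\<dots> = (\<Sum>Z\<in>Y. card Z)"
    using class_nonempty assms by (intro sum.cong refl le_add_diff_inverse2) blast
  finally show ?thesis using card_Union_classes[OF assms] by simp
qed

lemma cls_in_image_plane_iff:
  assumes "e \<in> E" "f \<in> E" "h \<in> E"
  shows "cls h \<in> cls ` plane e f \<longleftrightarrow> h \<in> plane e f"
proof
  assume "cls h \<in> cls ` plane e f"
  then obtain x where x: "x \<in> plane e f" "cls h = cls x" by auto
  then have "cls h \<subseteq> plane e f" using cls_subset_plane[OF assms(1,2)] by simp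
  then show "h \<in> plane e f" using in_cls_self[OF assms(3)] by blast
qed simp

lemma unique_plane:
  assumes "Z \<in> classes" "Z' \<in> classes" "Z' \<noteq> Z"
  shows "\<exists>!Y. Y \<in> planes \<and> Z \<in> Y \<and> Z' \<in> Y"
proof -
  obtain e f where ef: "e \<in> E" "f \<in> E" "Z = cls e" "Z' = cls f" using assms by (auto simp: classes_def)
  show ?thesis
  proof (rule ex1I)
    show "cls ` plane e f \<in> planes \<and> Z \<in> cls ` plane e f \<and> Z' \<in> cls ` plane e f"
      using ef assms(3) in_plane unfolding planes_def by auto
  next
    fix Y assume "Y \<in> planes \<and> Z \<in> Y \<and> Z' \<in> Y"
    then obtain a b where ab: "a \<in> E" "b \<in> E" "Y = cls ` plane a b" "cls e \<in> Y" "cls f \<in> Y"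
      using ef by (auto simp: planes_def)
    then have "plane e f = plane a b"
      using cls_in_image_plane_iff ef assms(3) by (intro plane_eq) auto
    with ab show "Y = cls ` plane e f" by simp
  qed
qed

lemma unique_line:
  assumes "e \<in> E" "f \<in> E" "f \<noteq> e"
  shows "\<exists>!B. B \<in> lines \<and> e \<in> B \<and> f \<in> B"
proof (rule ex1I)
  show "line e f \<in> lines \<and> e \<in> line e f \<and> f \<in> line e f"
    using assms in_line unfolding lines_def by blast
next
  fix B assume "B \<in> lines \<and> e \<in> B \<and> f \<in> B"
  then obtain a b where "a \<in> E" "b \<in> E" "B = line a b" "e \<in> B" "f \<in> B" by (auto simp: lines_def)
  with assms line_eq[of a b e f] show "B = line e f" by auto
qed

lemma sum_lines_through: "e \<in> E \<Longrightarrow> (\<Sum>B\<in>{B \<in> lines. e \<in> B}. card B - 1) = card E - 1"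
proof (rule sum_blocks_through_point[OF finite_E finite_lines _ _ unique_line])
  show "B \<in> lines \<Longrightarrow> B \<subseteq> E" for B using line_subset by (auto simp: lines_def)
qed

lemma sum_planes_through: "Z \<in> classes \<Longrightarrow> (\<Sum>Y\<in>{Y \<in> planes. Z \<in> Y}. card Y - 1) = card classes - 1"
  by (rule sum_blocks_through_point[OF finite_classes finite_planes plane_subset_classes _ unique_plane])

text \<open>The condition on the fibres selects the lines of the plane that miss
  \<open>w\<close>.\<close>

definition lines_in :: "'i set set \<Rightarrow> 'i set set" where
  "lines_in Y = {line e f |e f. e \<in> \<Union>Y \<and> f \<in> \<Union>Y \<and> cls e \<noteq> cls f}"

lemma Union_subset_E: "Y \<in> planes \<Longrightarrow> \<Union>Y \<subseteq> E"
  using plane_subset_classes cls_subset by (fastforce simp: classes_def)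

lemma lines_in_subset: "Y \<in> planes \<Longrightarrow> lines_in Y \<subseteq> lines"
  unfolding lines_in_def lines_def using Union_subset_E by blast

text \<open>A line that misses \<open>w\<close> spans a single plane together with
  \<open>w\<close>.\<close>

lemma lines_in_disjoint:
  assumes "Y \<in> planes" "Y' \<in> planes" "B \<in> lines_in Y" "B \<in> lines_in Y'"
  shows "Y = Y'"
proof -
  obtain e f where ef: "B = line e f" "e \<in> \<Union>Y" "f \<in> \<Union>Y" "cls e \<noteq> cls f"
    using assms(3) by (auto simp: lines_in_def)
  obtain a b where ab: "B = line a b" "a \<in> \<Union>Y'" "b \<in> \<Union>Y'" "cls a \<noteq> cls b"
    using assms(4) by (auto simp: lines_in_def)
  have E: "e \<in> E" "f \<in> E" "a \<in> E" "b \<in> E" using ef ab Union_subset_E assms by blast+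
  obtain a' b' where Y': "a' \<in> E" "b' \<in> E" "Y' = cls ` plane a' b'" using assms(2) by (auto simp: planes_def)
  have "line a b \<subseteq> plane a b" using line_subset_plane E by simp
  moreover have "plane a b = plane a' b'"
    using plane_eq[of a' b' a b] Y' ab Union_plane[of a' b'] by auto
  ultimately have "B \<subseteq> plane a' b'" using ab by simp
  then have "cls e \<in> Y'" "cls f \<in> Y'" using in_line[of e f] E ef Y' by auto
  moreover have "cls e \<in> Y" "cls f \<in> Y"
  proof -
    obtain u v where Y: "u \<in> E" "v \<in> E" "Y = cls ` plane u v" using assms(1) by (auto simp: planes_def)
    then show "cls e \<in> Y" "cls f \<in> Y" using Union_plane[of u v] ef by auto
  qed
  moreover have "cls e \<in> classes" "cls f \<in> classes" using E by (auto simp: classes_def)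
  ultimately show ?thesis using unique_plane[of "cls e" "cls f"] ef(4) assms by auto
qed

text \<open>Such a fibre is a line through \<open>w\<close>, so it belongs to no
  \<open>lines_in Y\<close> and can be added to the sum separately.\<close>

lemma big_class_is_line:
  assumes "Z \<in> classes" "card Z \<ge> 2"
  shows "Z \<in> lines" "\<forall>Y\<in>planes. Z \<notin> lines_in Y"
proof -
  obtain e where e: "e \<in> E" "Z = cls e" using assms by (auto simp: classes_def)
  have "Z \<noteq> {e}" using assms(2) by auto
  then obtain f where f: "f \<in> cls e" "f \<noteq> e" using in_cls_self e by auto
  then have fE: "f \<in> E" and fs: "g f \<in> vec.span {g e, w}" by (auto simp: cls_def)
  have "vec.span {g f, g e} = vec.span {g e, w}"
  proof (rule span_eq_if_independent_card)
    show "vec.independent {g f, g e}" by (rule independent_pair) (use distinct f fE e g_nonzero in auto)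
    have "g f \<noteq> g e" using distinct[OF fE e(1) f(2)] by (auto simp: vec.span_base)
    then show "card {g e, w} \<le> card {g f, g e}" by (simp add: card_insert_if)
    show "{g f, g e} \<subseteq> vec.span {g e, w}" using fs vec.span_base[of "g e" "{g e, w}"] by auto
  qed simp
  then have "Z = line f e" by (simp add: e cls_def line_def)
  then show "Z \<in> lines" using fE e f unfolding lines_def by blast
  show "\<forall>Y\<in>planes. Z \<notin> lines_in Y"
  proof (intro ballI notI)
    fix Y assume Y: "Y \<in> planes" "Z \<in> lines_in Y"
    then obtain a b where ab: "Z = line a b" "a \<in> \<Union>Y" "b \<in> \<Union>Y" "cls a \<noteq> cls b"
      by (auto simp: lines_in_def)
    then have "a \<in> E" "b \<in> E" using Union_subset_E Y by blast+
    then have "a \<in> cls e" "b \<in> cls e" using ab in_line e by auto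
    then have "cls a = cls b" using in_cls_iff e by auto
    with ab show False by simp
  qed
qed

text \<open>The factor \<open>N + 1 - r\<close> of the planar inequality becomes a sum over the
  fibres in the plane; in this form it can be summed over all planes.\<close>

lemma plane_inequality_classes:
  assumes "Y \<in> planes"
  shows "(card Y - 1) * (1 + (\<Sum>Z\<in>Y. card Z - 1)) \<le> (\<Sum>B\<in>lines_in Y. card B - 1)"
proof -
  obtain e f where ef: "e \<in> E" "f \<in> E" "cls e \<noteq> cls f" "Y = cls ` plane e f"
    using assms by (auto simp: planes_def)
  have U: "\<Union>Y = plane e f" using Union_plane ef by simp
  have "(\<Sum>Z\<in>Y. card Z - 1) + card Y = card (plane e f)"
    using sum_card_classes_minus_one[OF plane_subset_classes[OF assms]] U by simp
  then have "card (plane e f) + 1 - card Y = 1 + (\<Sum>Z\<in>Y. card Z - 1)" by linarith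
  then show ?thesis using plane_inequality[OF ef(1-3)] by (simp add: lines_in_def U flip: ef(4))
qed

text \<open>In the sum of the planar inequalities, the 1 in each factor yields the first sum.
  Exchanging summation gives each fibre the weight \<open>card classes - 1\<close>, since the planes
  through it partition the other fibres. Fibres with at least two points are lines themselves and
  raise the weight to \<open>card classes\<close>.\<close>

theorem central_inequality:
  "(\<Sum>Y\<in>planes. card Y - 1) + card classes * (card E - card classes) \<le> (\<Sum>B\<in>lines. card B - 1)"
proof (cases "E = {}")
  case False
  define m where "m Z = card Z - 1" for Z :: "'i set"
  define \<C> where "\<C> = {Z \<in> classes. card Z \<ge> 2}"
  have h: "card classes \<ge> 1" using False finite_classes by (auto simp: classes_def Suc_le_eq card_gt_0_iff finite_E)
  have UE: "\<Union>classes = E" using in_cls_self cls_subset by (fastforce simp: classes_def)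
  have sm: "(\<Sum>Z\<in>classes. m Z) + card classes = card E"
    using sum_card_classes_minus_one[of classes] UE by (simp add: m_def)
  have "(\<Sum>Y\<in>planes. (card Y - 1) * (\<Sum>Z\<in>Y. m Z)) = (\<Sum>Y\<in>planes. \<Sum>Z\<in>classes. if Z \<in> Y then (card Y - 1) * m Z else 0)"
  proof (rule sum.cong[OF refl])
    fix Y assume "Y \<in> planes"
    then have "{Z \<in> classes. Z \<in> Y} = Y" using plane_subset_classes by blast
    then show "(card Y - 1) * (\<Sum>Z\<in>Y. m Z) = (\<Sum>Z\<in>classes. if Z \<in> Y then (card Y - 1) * m Z else 0)"
      by (simp add: sum_distrib_left flip: sum.inter_filter)
  qed
  also have "\<dots> = (\<Sum>Z\<in>classes. \<Sum>Y\<in>planes. if Z \<in> Y then (card Y - 1) * m Z else 0)"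
    by (rule sum.swap)
  also have "\<dots> = (\<Sum>Z\<in>classes. (card classes - 1) * m Z)"
  proof (rule sum.cong[OF refl])
    fix Z assume "Z \<in> classes"
    have "(\<Sum>Y\<in>planes. if Z \<in> Y then (card Y - 1) * m Z else 0) = (\<Sum>Y\<in>{Y \<in> planes. Z \<in> Y}. card Y - 1) * m Z"
      by (simp add: sum_distrib_right flip: sum.inter_filter)
    then show "(\<Sum>Y\<in>planes. if Z \<in> Y then (card Y - 1) * m Z else 0) = (card classes - 1) * m Z"
      using sum_planes_through[OF \<open>Z \<in> classes\<close>] by simp
  qed
  also have "\<dots> = (card classes - 1) * (card E - card classes)"
    using sm by (simp add: sum_distrib_left[symmetric]) (metis add_diff_cancel_right')
  finally have swap: "(\<Sum>Y\<in>planes. (card Y - 1) * (\<Sum>Z\<in>Y. m Z)) = (card classes - 1) * (card E - card classes)" .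
  have fin: "finite (lines_in Y)" if "Y \<in> planes" for Y
    using lines_in_subset[OF that] by (rule finite_subset) simp
  have split: "card classes * (card E - card classes) = (card classes - 1) * (card E - card classes) + (card E - card classes)"
    using h by (cases "card classes") auto
  have "(\<Sum>Z\<in>classes. m Z) = (\<Sum>Z\<in>\<C>. m Z)"
    by (rule sum.mono_neutral_right) (auto simp: \<C>_def m_def)
  then have mC: "card E - card classes = (\<Sum>Z\<in>\<C>. m Z)" using sm by linarith
  have "(\<Sum>Y\<in>planes. (card Y - 1) * (1 + (\<Sum>Z\<in>Y. m Z)))
      = (\<Sum>Y\<in>planes. card Y - 1) + (\<Sum>Y\<in>planes. (card Y - 1) * (\<Sum>Z\<in>Y. m Z))"
    by (simp only: distrib_left mult_1_right sum.distrib)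
  then have "(\<Sum>Y\<in>planes. card Y - 1) + card classes * (card E - card classes)
      = (\<Sum>Y\<in>planes. (card Y - 1) * (1 + (\<Sum>Z\<in>Y. m Z))) + (\<Sum>Z\<in>\<C>. m Z)"
    using swap split mC by linarith
  also have "\<dots> \<le> (\<Sum>Y\<in>planes. \<Sum>B\<in>lines_in Y. card B - 1) + (\<Sum>Z\<in>\<C>. card Z - 1)"
    using plane_inequality_classes unfolding m_def by (intro add_mono sum_mono) auto
  also have "(\<Sum>Y\<in>planes. \<Sum>B\<in>lines_in Y. card B - 1) = (\<Sum>B\<in>(\<Union>Y\<in>planes. lines_in Y). card B - 1)"
    using fin lines_in_disjoint by (intro sum.UNION_disjoint[symmetric]) auto
  also have "\<dots> + (\<Sum>Z\<in>\<C>. card Z - 1) = (\<Sum>B\<in>(\<Union>Y\<in>planes. lines_in Y) \<union> \<C>. card B - 1)"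
    using fin big_class_is_line(2) by (intro sum.union_disjoint[symmetric]) (auto simp: \<C>_def)
  also have "\<dots> \<le> (\<Sum>B\<in>lines. card B - 1)"
    using lines_in_subset big_class_is_line(1) by (intro sum_mono2) (auto simp: \<C>_def)
  finally show ?thesis .
next
  case True
  then have "planes = {}" "classes = {}" unfolding planes_def classes_def by (simp_all add: True)
  then show ?thesis by simp
qed

end

section \<open>Affine hyperplanes as points\<close>

text \<open>Affine forms are vectors over \<open>'n option\<close>, with the constant term at
  \<open>None\<close>, so that spans of forms are spans of vectors and the constant form is one of
  them.\<close>

definition eval_affine :: "'k::field ^ 'n option \<Rightarrow> 'k ^ 'n \<Rightarrow> 'k" where
  "eval_affine v x = (\<Sum>i\<in>UNIV. v $ Some i * x $ i) + v $ None"

definition zeros :: "('k::field ^ 'n option) set \<Rightarrow> ('k ^ 'n) set" where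
  "zeros S = {x. \<forall>v\<in>S. eval_affine v x = 0}"

definition lin_part :: "'k::field ^ 'n option \<Rightarrow> 'k ^ 'n \<Rightarrow> 'k" where
  "lin_part v d = (\<Sum>i\<in>UNIV. v $ Some i * d $ i)"

lemma eval_affine_add: "eval_affine v (x + d) = eval_affine v x + lin_part v d"
  by (simp add: eval_affine_def lin_part_def sum.distrib algebra_simps)

lemma lin_part_diff_eq: "lin_part v (x - y) = eval_affine v x - eval_affine v y"
  by (simp add: eval_affine_def lin_part_def sum_subtractf algebra_simps)

lemma lin_part_simps: "lin_part v (x + y) = lin_part v x + lin_part v y"
  "lin_part v (t *s x) = t * lin_part v x" "lin_part v 0 = 0"
  "lin_part v (x - y) = lin_part v x - lin_part v y"
  by (simp_all add: lin_part_def sum.distrib sum_subtractf sum_distrib_left algebra_simps)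

lemma eval_affine_simps: "eval_affine (u + v) x = eval_affine u x + eval_affine v x"
  "eval_affine (t *s v) x = t * eval_affine v x" "eval_affine 0 x = 0"
  by (simp_all add: eval_affine_def sum.distrib sum_distrib_left algebra_simps)

lemma zeros_insert: "zeros (insert v S) = zeros {v} \<inter> zeros S"
  by (auto simp: zeros_def)

lemma zeros_empty [simp]: "zeros {} = UNIV"
  by (simp add: zeros_def)

lemma zeros_span_subset: "u \<in> vec.span S \<Longrightarrow> zeros S \<subseteq> zeros {u}"
proof
  fix x assume u: "u \<in> vec.span S" and x: "x \<in> zeros S"
  have "vec.subspace {v. eval_affine v x = 0}"
    by (rule vec.subspaceI) (auto simp: eval_affine_simps)
  then have "vec.span S \<subseteq> {v. eval_affine v x = 0}"
    by (rule vec.span_minimal[rotated]) (use x in \<open>auto simp: zeros_def\<close>)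
  with u show "x \<in> zeros {u}" by (auto simp: zeros_def)
qed

lemma separating_functional:
  fixes u :: "'k::field ^ 'm"
  assumes "u \<notin> vec.span S"
  obtains y where "\<And>v. v \<in> S \<Longrightarrow> (\<Sum>i\<in>UNIV. v $ i * y $ i) = 0" "(\<Sum>i\<in>UNIV. u $ i * y $ i) \<noteq> 0"
proof -
  obtain B where B: "B \<subseteq> S" "vec.independent B" "S \<subseteq> vec.span B"
    by (rule vec.maximal_independent_subset)
  have u: "u \<notin> vec.span B" using assms vec.span_mono[OF B(1)] by blast
  have "vec.independent (insert u B)" using u B(2) by (simp add: vec.independent_insert)
  \<comment> \<open>Any coordinate will do: the functional is coordinate \<open>a\<close> of a
    linear map that kills \<open>B\<close> and sends \<open>u\<close> to a unit vector, and
    \<open>y\<close> is row \<open>a\<close> of its matrix.\<close>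
  fix a :: 'm
  obtain f where f: "Vector_Spaces.linear (*s) (*s) f"
    "\<forall>x\<in>insert u B. f x = (if x = u then axis a 1 else (0 :: 'k ^ 'm))"
    using vec.linear_independent_extend[OF \<open>vec.independent (insert u B)\<close>,
        of "\<lambda>x. if x = u then axis a 1 else (0 :: 'k ^ 'm)"] by (elim exE conjE) (rule that)
  have uB: "u \<notin> B" using u vec.span_base by blast
  have "vec.subspace {x. f x = 0}"
    using f(1) by (intro vec.subspaceI) (auto simp: vec.linear_0 vec.linear_add vec.linear_scale)
  then have "vec.span B \<subseteq> {x. f x = 0}"
    by (rule vec.span_minimal[rotated]) (use f(2) uB in auto)
  then have fS: "f v = 0" if "v \<in> S" for v using B(3) that by blast
  have comp: "f x $ a = (\<Sum>i\<in>UNIV. x $ i * matrix f $ a $ i)" for x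
    using matrix_works[OF f(1), of x, symmetric] by (simp add: matrix_vector_mult_def mult.commute)
  show thesis
  proof (rule that[of "matrix f $ a"])
    show "(\<Sum>i\<in>UNIV. v $ i * matrix f $ a $ i) = 0" if "v \<in> S" for v
      using comp[of v] fS[OF that] by simp
    show "(\<Sum>i\<in>UNIV. u $ i * matrix f $ a $ i) \<noteq> 0"
      using comp[of u] f(2) by (simp add: axis_def)
  qed
qed

lemma sum_option: "(\<Sum>i\<in>(UNIV :: 'n::finite option set). h i) = (\<Sum>i\<in>UNIV. h (Some i)) + (h None :: 'k::field)"
  by (simp add: UNIV_option_conv sum.reindex add.commute)

definition infinity_form :: "'k::field ^ 'n::finite option" where
  "infinity_form = axis None 1"

lemma eval_infinity_form [simp]: "eval_affine infinity_form x = 1"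
  by (simp add: infinity_form_def eval_affine_def axis_def)

lemma eval_affine_point:
  assumes "y $ None \<noteq> 0"
  shows "(\<Sum>i\<in>UNIV. v $ i * y $ i) = y $ None * eval_affine v (\<chi> i. y $ Some i / y $ None)"
  using assms by (simp add: sum_option eval_affine_def distrib_left sum_distrib_left mult_ac)

lemma eval_affine_direction:
  assumes "y $ None = 0"
  shows "(\<Sum>i\<in>UNIV. v $ i * y $ i) = lin_part v (\<chi> i. y $ Some i)"
  using assms by (simp add: sum_option lin_part_def)

text \<open>Otherwise some vector annihilates \<open>S\<close> and has a nonzero \<open>None\<close>
  coordinate; scaling that coordinate to 1 gives a common zero of \<open>S\<close>.\<close>

lemma infinity_form_in_span:
  assumes "zeros S = {}"
  shows "infinity_form \<in> vec.span S"
proof (rule ccontr)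
  assume "infinity_form \<notin> vec.span S"
  then obtain y where y: "\<And>v. v \<in> S \<Longrightarrow> (\<Sum>i\<in>UNIV. v $ i * y $ i) = 0"
    "(\<Sum>i\<in>UNIV. infinity_form $ i * y $ i) \<noteq> 0" by (rule separating_functional) blast
  then have "y $ None \<noteq> 0" by (simp add: infinity_form_def axis_def sum_option)
  then have "(\<chi> i. y $ Some i / y $ None) \<in> zeros S"
    using y(1) by (auto simp: zeros_def eval_affine_point[OF \<open>y $ None \<noteq> 0\<close>])
  with assms show False by simp
qed

text \<open>A separating vector is a direction if its \<open>None\<close> coordinate is 0, and
  otherwise a point up to scaling. A direction has to be added to a given zero of \<open>S\<close>,
  which is where nonemptiness enters.\<close>

lemma in_span_if_vanishing:
  assumes "zeros S \<noteq> {}" "zeros S \<subseteq> zeros {u}"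
  shows "u \<in> vec.span S"
proof (rule ccontr)
  assume "u \<notin> vec.span S"
  then obtain y where y: "\<And>v. v \<in> S \<Longrightarrow> (\<Sum>i\<in>UNIV. v $ i * y $ i) = 0"
    "(\<Sum>i\<in>UNIV. u $ i * y $ i) \<noteq> 0" by (rule separating_functional) blast
  obtain x where x: "x \<in> zeros S" using assms(1) by blast
  show False
  proof (cases "y $ None = 0")
    case True
    let ?x = "x + (\<chi> i. y $ Some i)"
    have "?x \<in> zeros S"
      using x y(1) eval_affine_direction[OF True] by (auto simp: zeros_def eval_affine_add)
    then have "eval_affine u ?x = 0" "eval_affine u x = 0" using assms(2) x by (auto simp: zeros_def)
    with y(2) eval_affine_direction[OF True, of u] show False by (simp add: eval_affine_add)
  next
    case False
    then have "(\<chi> i. y $ Some i / y $ None) \<in> zeros S"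
      using y(1) False by (auto simp: zeros_def eval_affine_point[OF False])
    then have "eval_affine u (\<chi> i. y $ Some i / y $ None) = 0" using assms(2) by (auto simp: zeros_def)
    with y(2) eval_affine_point[OF False, of u] show False by simp
  qed
qed

lemma span_iff_zeros_subset: "zeros S \<noteq> {} \<Longrightarrow> u \<in> vec.span S \<longleftrightarrow> zeros S \<subseteq> zeros {u}"
  using in_span_if_vanishing zeros_span_subset by blast

lemma affine_dim_mono: "X \<subseteq> Y \<Longrightarrow> affine_dim X \<le> affine_dim Y"
  unfolding affine_dim_def by (rule vec.dim_subset) blast

lemma directions_zeros:
  assumes "x0 \<in> zeros S"
  shows "{x - y |x y. x \<in> zeros S \<and> y \<in> zeros S} = {d. \<forall>v\<in>S. lin_part v d = 0}"
proof (intro equalityI subsetI)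
  fix d assume "d \<in> {d. \<forall>v\<in>S. lin_part v d = 0}"
  then have "x0 + d \<in> zeros S" "d = (x0 + d) - x0" using assms by (auto simp: zeros_def eval_affine_add)
  with assms show "d \<in> {x - y |x y. x \<in> zeros S \<and> y \<in> zeros S}" by blast
qed (auto simp: zeros_def lin_part_diff_eq)

lemma affine_dim_cut:
  assumes "zeros S \<inter> zeros {v} \<noteq> {}" "\<not> zeros S \<subseteq> zeros {v}"
  shows "affine_dim (zeros S \<inter> zeros {v}) + 1 = affine_dim (zeros S)"
proof -
  let ?D = "{d. \<forall>u\<in>S. lin_part u d = 0}"
  let ?D' = "{d. \<forall>u\<in>insert v S. lin_part u d = 0}"
  obtain x0 where x0: "x0 \<in> zeros S" "x0 \<in> zeros {v}" using assms(1) by blast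
  obtain x1 where x1: "x1 \<in> zeros S" "x1 \<notin> zeros {v}" using assms(2) by blast
  \<comment> \<open>\<open>u\<close> leads from a point of the section to a point outside it, and
    spans a complement of the new direction space in the old one.\<close>
  define u where "u = x1 - x0"
  have u: "u \<in> ?D" "lin_part v u \<noteq> 0" using x0 x1 by (auto simp: u_def zeros_def lin_part_diff_eq)
  have sub': "vec.subspace ?D'" by (rule vec.subspaceI) (auto simp: lin_part_simps)
  have sub: "vec.subspace ?D" by (rule vec.subspaceI) (auto simp: lin_part_simps)
  have "u \<notin> vec.span ?D'" using u(2) unfolding vec.span_eq_iff[THEN iffD2, OF sub'] by simp
  then have "vec.dim (insert u ?D') = vec.dim ?D' + 1" by (simp add: vec.dim_insert)
  also have "vec.dim (insert u ?D') = vec.dim ?D"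
  proof (rule antisym)
    show "vec.dim (insert u ?D') \<le> vec.dim ?D" by (rule vec.dim_subset) (use u in auto)
    have "?D \<subseteq> vec.span (insert u ?D')"
    proof
      fix d assume d: "d \<in> ?D"
      let ?t = "lin_part v d / lin_part v u"
      have "d - ?t *s u \<in> ?D'" using d u by (auto simp: lin_part_simps)
      then have "(d - ?t *s u) + ?t *s u \<in> vec.span (insert u ?D')"
        by (intro vec.span_add vec.span_scale vec.span_base) auto
      then show "d \<in> vec.span (insert u ?D')" by simp
    qed
    then show "vec.dim ?D \<le> vec.dim (insert u ?D')"
      using vec.dim_subset[of ?D "vec.span (insert u ?D')"] by simp
  qed
  finally have "vec.dim ?D = vec.dim ?D' + 1" by simp
  moreover have "zeros S \<inter> zeros {v} = zeros (insert v S)" using zeros_insert[of v S] by blast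
  moreover have "x0 \<in> zeros (insert v S)" using x0 zeros_insert[of v S] by blast
  ultimately show ?thesis
    unfolding affine_dim_def using directions_zeros[OF x0(1)] directions_zeros[of x0 "insert v S"] by simp
qed

lemma affine_dim_UNIV: "affine_dim (UNIV :: ('k::field ^ 'n) set) = CARD('n)"
proof -
  have "x \<in> {x - y |x y. x \<in> UNIV \<and> y \<in> UNIV}" for x :: "'k ^ 'n"
    using diff_0_right[of x] by (metis (mono_tags, lifting) UNIV_I mem_Collect_eq)
  then have "{x - y |x y. x \<in> UNIV \<and> y \<in> UNIV} = (UNIV :: ('k ^ 'n) set)" by blast
  then show ?thesis unfolding affine_dim_def by (simp only: vec_dim_card)
qed

section \<open>Flats of codimension at most two and their Moebius values\<close>

definition pair_meets :: "'p set set \<Rightarrow> 'p set set" where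
  "pair_meets A = {K \<inter> K' |K K'. K \<in> A \<and> K' \<in> A \<and> K \<noteq> K' \<and> K \<inter> K' \<noteq> {}}"

text \<open>A general \<open>W\<close> lets the same argument serve \<open>A\<close> in the whole
  space and the restriction in \<open>H\<close>.\<close>

locale hyperplanes_in =
  fixes W :: "('k::field ^ 'n) set" and A :: "('k ^ 'n) set set"
  assumes W: "\<exists>S. W = zeros S"
    and finite_A: "finite A"
    and hyp: "K \<in> A \<Longrightarrow> \<exists>v. K = W \<inter> zeros {v}"
    and nonempty: "K \<in> A \<Longrightarrow> K \<noteq> {}"
    and proper: "K \<in> A \<Longrightarrow> K \<noteq> W"
    and W_nonempty: "W \<noteq> {}"
begin

lemma flat_zeros: "X \<in> flats W A \<Longrightarrow> \<exists>S. X = zeros S"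
proof -
  assume "X \<in> flats W A"
  then obtain B where B: "B \<subseteq> A" "X = W \<inter> \<Inter>B" by (auto simp: flats_def)
  obtain S where S: "W = zeros S" using W by blast
  obtain v where v: "\<And>K. K \<in> A \<Longrightarrow> K = W \<inter> zeros {v K}" using hyp by metis
  have "X = zeros (S \<union> v ` B)"
    unfolding B(2) using v B(1) S by (fastforce simp: zeros_def)
  then show ?thesis by blast
qed

lemma flat_subset: "X \<in> flats W A \<Longrightarrow> X \<subseteq> W"
  by (auto simp: flats_def)

lemma flat_cut:
  assumes "X \<in> flats W A" "K \<in> A" "X \<inter> K \<noteq> {}" "\<not> X \<subseteq> K"
  shows "affine_dim (X \<inter> K) + 1 = affine_dim X"
proof -
  obtain S where S: "X = zeros S" using flat_zeros[OF assms(1)] by blast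
  obtain v where v: "K = W \<inter> zeros {v}" using hyp[OF assms(2)] by blast
  have "X \<inter> K = zeros S \<inter> zeros {v}" using flat_subset[OF assms(1)] S v by blast
  then show ?thesis using affine_dim_cut[of S v] assms(3,4) S by auto
qed

lemma W_flat: "W \<in> flats W A"
  using W_nonempty by (auto simp: flats_def intro: exI[of _ "{}"])

lemma hyp_flat: "K \<in> A \<Longrightarrow> K \<in> flats W A"
  using hyp[of K] nonempty[of K] by (auto simp: flats_def intro!: exI[of _ "{K}"])

lemma hyp_subset: "K \<in> A \<Longrightarrow> K \<subseteq> W"
  using hyp by blast

lemma meet_flat: "K \<in> A \<Longrightarrow> K' \<in> A \<Longrightarrow> K \<inter> K' \<noteq> {} \<Longrightarrow> K \<inter> K' \<in> flats W A"
  using hyp_subset[of K] by (auto simp: flats_def intro!: exI[of _ "{K, K'}"])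

lemma flat_psubset_dim:
  assumes X: "X \<in> flats W A" and Y: "Y \<in> flats W A" and "X \<subset> Y"
  shows "affine_dim X < affine_dim Y"
proof -
  obtain B where B: "B \<subseteq> A" "X = W \<inter> \<Inter>B" "X \<noteq> {}" using X by (auto simp: flats_def)
  have "\<exists>K\<in>B. \<not> Y \<subseteq> K"
  proof (rule ccontr)
    assume "\<not> ?thesis"
    then have "Y \<subseteq> X" using B flat_subset[OF Y] by blast
    with assms(3) show False by blast
  qed
  then obtain K where K: "K \<in> B" "\<not> Y \<subseteq> K" by blast
  have XYK: "X \<subseteq> Y \<inter> K" using assms(3) B K by blast
  then have "affine_dim (Y \<inter> K) + 1 = affine_dim Y" using flat_cut[OF Y, of K] K B by blast
  with affine_dim_mono[OF XYK] show ?thesis by linarith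
qed

lemma hyp_dim: "K \<in> A \<Longrightarrow> affine_dim K + 1 = affine_dim W"
  using flat_cut[OF W_flat, of K] hyp_subset[of K] nonempty[of K] proper[of K] by (auto simp: Int_absorb1)

lemma meet_dim:
  assumes "K \<in> A" "K' \<in> A" "K \<noteq> K'" "K \<inter> K' \<noteq> {}"
  shows "affine_dim (K \<inter> K') + 2 = affine_dim W"
proof -
  have "\<not> K \<subseteq> K'"
  proof
    assume "K \<subseteq> K'"
    then have "affine_dim K < affine_dim K'"
      using assms(3) by (intro flat_psubset_dim hyp_flat assms(1,2)) blast
    then show False using hyp_dim[OF assms(1)] hyp_dim[OF assms(2)] by linarith
  qed
  then show ?thesis using flat_cut[OF hyp_flat[OF assms(1)] assms(2,4)] hyp_dim[OF assms(1)] by simp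
qed

lemma flat_cases:
  assumes "X \<in> flats W A"
  obtains "X = W" | "X \<in> A" | K K' where "K \<in> A" "K' \<in> A" "K \<noteq> K'" "X \<subseteq> K \<inter> K'" "K \<inter> K' \<noteq> {}"
proof -
  obtain B where B: "B \<subseteq> A" "X = W \<inter> \<Inter>B" "X \<noteq> {}" using assms by (auto simp: flats_def)
  consider "B = {}" | K where "B = {K}" | K K' where "K \<in> B" "K' \<in> B" "K \<noteq> K'" by blast
  then show thesis
  proof cases
    case 1
    then show ?thesis using that(1) B by simp
  next
    case 2
    then have "X = K" using B hyp_subset by auto
    then show ?thesis using that(2) B 2 by blast
  next
    case 3
    then show ?thesis using that(3)[of K K'] B by blast
  qed
qed

lemma flats_dim_top: "X \<in> flats W A \<Longrightarrow> affine_dim X = affine_dim W \<Longrightarrow> X = W"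
  using flat_psubset_dim[OF _ W_flat, of X] flat_subset[of X] by auto

lemma flats_codim1: "{X \<in> flats W A. affine_dim X + 1 = affine_dim W} = A"
proof (intro equalityI subsetI)
  fix X assume X: "X \<in> {X \<in> flats W A. affine_dim X + 1 = affine_dim W}"
  then have "X \<in> flats W A" by simp
  then show "X \<in> A"
  proof (cases rule: flat_cases)
    case (3 K K')
    then show ?thesis using meet_dim[of K K'] affine_dim_mono[of X "K \<inter> K'"] X by auto
  qed (use X in auto)
qed (use hyp_flat hyp_dim in auto)

lemma flats_codim2: "{X \<in> flats W A. affine_dim X + 2 = affine_dim W} = pair_meets A"
proof (intro equalityI subsetI)
  fix X assume X: "X \<in> {X \<in> flats W A. affine_dim X + 2 = affine_dim W}"
  then have XF: "X \<in> flats W A" by simp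
  then show "X \<in> pair_meets A"
  proof (cases rule: flat_cases)
    case 2
    then show ?thesis using hyp_dim[of X] X by auto
  next
    case (3 K K')
    then have "X = K \<inter> K'"
      using flat_psubset_dim[OF XF meet_flat[of K K']] meet_dim[of K K'] X by auto
    then show ?thesis using 3 by (auto simp: pair_meets_def)
  qed (use X in auto)
next
  fix X assume "X \<in> pair_meets A"
  then obtain K K' where "K \<in> A" "K' \<in> A" "K \<noteq> K'" "X = K \<inter> K'" "K \<inter> K' \<noteq> {}"
    by (auto simp: pair_meets_def)
  then show "X \<in> {X \<in> flats W A. affine_dim X + 2 = affine_dim W}" using meet_dim meet_flat by simp
qed

lemma mu_hyp: "K \<in> A \<Longrightarrow> mu W A K = -1"
proof -
  assume K: "K \<in> A"
  have "{Y \<in> flats W A. K \<subset> Y \<and> Y \<subseteq> W} = {W}"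
  proof (intro equalityI subsetI)
    fix Y assume Y: "Y \<in> {Y \<in> flats W A. K \<subset> Y \<and> Y \<subseteq> W}"
    then have "affine_dim K < affine_dim Y" "affine_dim Y \<le> affine_dim W"
      using flat_psubset_dim[OF hyp_flat[OF K]] affine_dim_mono by auto
    then have "affine_dim Y = affine_dim W" using hyp_dim[OF K] by linarith
    then show "Y \<in> {W}" using flats_dim_top Y by auto
  qed (use W_flat hyp_subset[OF K] proper[OF K] in auto)
  then show ?thesis using mu_below[OF finite_A proper[OF K]] by (simp add: mu_top)
qed

text \<open>Strictly above \<open>X\<close> lie \<open>W\<close> with value 1 and the
  \<open>n\<close> hyperplanes through \<open>X\<close> with value -1 each. The result
  \<open>n - 1\<close> is the term \<open>|B| - 1\<close> of the line \<open>B\<close> formed by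
  these hyperplanes.\<close>

lemma mu_meet:
  assumes "X \<in> pair_meets A"
  shows "mu W A X = int (card {K \<in> A. X \<subseteq> K}) - 1"
proof -
  have X: "X \<in> flats W A" "affine_dim X + 2 = affine_dim W" using assms flats_codim2 by auto
  have "{Y \<in> flats W A. X \<subset> Y \<and> Y \<subseteq> W} = insert W {K \<in> A. X \<subseteq> K}"
  proof (intro equalityI subsetI)
    fix Y assume Y: "Y \<in> {Y \<in> flats W A. X \<subset> Y \<and> Y \<subseteq> W}"
    then have "affine_dim X < affine_dim Y" "affine_dim Y \<le> affine_dim W"
      using flat_psubset_dim[OF X(1)] affine_dim_mono by auto
    then have "affine_dim Y = affine_dim W \<or> affine_dim Y + 1 = affine_dim W" using X(2) by linarith
    then show "Y \<in> insert W {K \<in> A. X \<subseteq> K}" using flats_dim_top flats_codim1 Y by auto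
  next
    fix Y assume "Y \<in> insert W {K \<in> A. X \<subseteq> K}"
    then show "Y \<in> {Y \<in> flats W A. X \<subset> Y \<and> Y \<subseteq> W}"
      using W_flat hyp_flat hyp_subset hyp_dim X flat_subset[OF X(1)] by fastforce
  qed
  moreover have "W \<notin> {K \<in> A. X \<subseteq> K}" using proper by auto
  moreover have "(\<Sum>K\<in>{K \<in> A. X \<subseteq> K}. mu W A K) = - int (card {K \<in> A. X \<subseteq> K})"
    using mu_hyp by simp
  ultimately show ?thesis using mu_below[OF finite_A, of X W] X finite_A by (auto simp: mu_top)
qed

lemma coeff_char_polynomial:
  "coeff (char_polynomial W A) k = (\<Sum>X\<in>{X \<in> flats W A. affine_dim X = k}. mu W A X)"
  unfolding char_polynomial_def coeff_sum
  using finite_flats[OF finite_A] by (simp add: sum.inter_filter)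

lemma coeff_codim1: "k + 1 = affine_dim W \<Longrightarrow> coeff (char_polynomial W A) k = - int (card A)"
proof -
  assume "k + 1 = affine_dim W"
  then have "affine_dim X = k \<longleftrightarrow> affine_dim X + 1 = affine_dim W" for X :: "('k ^ 'n) set" by linarith
  then have "{X \<in> flats W A. affine_dim X = k} = A" using flats_codim1 by simp
  then show ?thesis by (simp add: coeff_char_polynomial mu_hyp)
qed

lemma coeff_codim2: "k + 2 = affine_dim W \<Longrightarrow>
  coeff (char_polynomial W A) k = (\<Sum>X\<in>pair_meets A. int (card {K \<in> A. X \<subseteq> K}) - 1)"
proof -
  assume "k + 2 = affine_dim W"
  then have "affine_dim X = k \<longleftrightarrow> affine_dim X + 2 = affine_dim W" for X :: "('k ^ 'n) set" by linarith
  then have "{X \<in> flats W A. affine_dim X = k} = pair_meets A" using flats_codim2 by simp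
  then show ?thesis by (simp add: coeff_char_polynomial mu_meet)
qed

end

section \<open>Dictionary between a hyperplane section and a projected configuration\<close>

lemma aff_hyperplane_zeros:
  assumes "aff_hyperplane H"
  shows "\<exists>v. zeros {v} = H" "H \<noteq> {}" "H \<noteq> UNIV"
proof -
  obtain a c where ac: "a \<noteq> 0" "H = {x. (\<Sum>i\<in>UNIV. a $ i * x $ i) = c}"
    using assms by (auto simp: aff_hyperplane_def)
  define v where "v = (\<chi> i. case i of None \<Rightarrow> - c | Some j \<Rightarrow> a $ j)"
  have "zeros {v} = H" by (auto simp: ac zeros_def eval_affine_def v_def)
  then show "\<exists>v. zeros {v} = H" ..
  obtain i where i: "a $ i \<noteq> 0" using ac(1) by (auto simp: vec_eq_iff)
  have val: "(\<Sum>j\<in>UNIV. a $ j * axis i (t / a $ i) $ j) = t" for t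
  proof -
    have "(\<Sum>j\<in>UNIV. a $ j * axis i (t / a $ i) $ j) = (\<Sum>j\<in>UNIV. if j = i then t else 0)"
      by (intro sum.cong) (auto simp: axis_def i)
    then show ?thesis by simp
  qed
  have "axis i (c / a $ i) \<in> H" "axis i ((c + 1) / a $ i) \<notin> H" by (simp_all add: ac val)
  then show "H \<noteq> {}" "H \<noteq> UNIV" by auto
qed

text \<open>The empty set stands for the hyperplane at infinity, represented by the constant form 1.\<close>

definition form :: "('k::field ^ 'n) set \<Rightarrow> 'k ^ 'n option" where
  "form K = (if K = {} then infinity_form else (SOME v. zeros {v} = K))"

lemma zeros_form: "K = {} \<or> aff_hyperplane K \<Longrightarrow> zeros {form K} = K"
  using aff_hyperplane_zeros(1)[of K] someI_ex[of "\<lambda>v. zeros {v} = K"]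
  by (auto simp: form_def zeros_def)

text \<open>\<open>H\<close> stays out of \<open>A\<close> because the centre of projection must not
  be one of the points. The case \<open>H \<in> A\<close> will follow from \<open>A - {H}\<close>,
  which has the same restriction.\<close>

locale hyperplane_section =
  fixes H :: "('k::field ^ 'n) set" and A :: "('k ^ 'n) set set"
  assumes hyperplane_H: "aff_hyperplane H"
    and finite_A: "finite A"
    and hyperplanes: "K \<in> A \<Longrightarrow> aff_hyperplane K"
    and H_notin: "H \<notin> A"
begin

abbreviation "E \<equiv> insert {} A"

lemma zeros_form_member: "K \<in> insert H E \<Longrightarrow> zeros {form K} = K"
  by (rule zeros_form) (use hyperplane_H hyperplanes in auto)

lemma form_nonzero: "K \<in> insert H E \<Longrightarrow> form K \<noteq> 0"
proof
  assume K: "K \<in> insert H E" "form K = 0"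
  then have "K = UNIV" using zeros_form_member[of K] by (auto simp: zeros_def eval_affine_simps)
  with K aff_hyperplane_zeros(3) hyperplane_H hyperplanes show False by auto
qed

lemma form_in_span_singleton:
  assumes "K \<in> insert H E" "L \<in> insert H E" "form K \<in> vec.span {form L}"
  shows "K = L"
proof -
  obtain t where t: "form K = t *s form L" using assms(3) by (auto simp: vec.span_singleton)
  then have "t \<noteq> 0" using form_nonzero[OF assms(1)] by auto
  then have "zeros {form K} = zeros {form L}" by (simp add: t zeros_def eval_affine_simps)
  then show ?thesis using zeros_form_member assms by simp
qed

sublocale P: projected_points E form "form H"
proof
  have "H \<noteq> {}" using aff_hyperplane_zeros(2)[OF hyperplane_H] .
  then show "form e \<notin> vec.span {form H}" if "e \<in> E" for e
    using form_in_span_singleton[of e H] H_notin that by auto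
  show "form e \<notin> vec.span {form f}" if "e \<in> E" "f \<in> E" "e \<noteq> f" for e f
    using form_in_span_singleton[of e f] that by auto
qed (use finite_A form_nonzero in auto)

lemma in_span_pair_iff:
  assumes "K \<in> insert H E" "L \<in> insert H E" "L' \<in> insert H E" "L \<inter> L' \<noteq> {}"
  shows "form K \<in> vec.span {form L, form L'} \<longleftrightarrow> L \<inter> L' \<subseteq> K"
proof -
  have "zeros {form L, form L'} = L \<inter> L'"
    using zeros_insert[of "form L" "{form L'}"] zeros_form_member assms by simp
  then show ?thesis using span_iff_zeros_subset[of "{form L, form L'}" "form K"] zeros_form_member assms by simp
qed

lemma in_span_triple_iff:
  assumes "K \<in> insert H E" "L \<in> insert H E" "L' \<in> insert H E" "L \<inter> L' \<inter> H \<noteq> {}"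
  shows "form K \<in> vec.span {form L, form L', form H} \<longleftrightarrow> L \<inter> L' \<inter> H \<subseteq> K"
proof -
  have "zeros {form L, form L', form H} = L \<inter> L' \<inter> H"
    using zeros_insert[of "form L" "{form L', form H}"] zeros_insert[of "form L'" "{form H}"]
      zeros_form_member assms by auto
  then show ?thesis
    using span_iff_zeros_subset[of "{form L, form L', form H}" "form K"] zeros_form_member assms by simp
qed

lemma infinity_in_span_pair:
  assumes "L \<in> insert H E" "L' \<in> insert H E" "L \<inter> L' = {}"
  shows "form {} \<in> vec.span {form L, form L'}"
proof -
  have "zeros {form L, form L'} = {}"
    using zeros_insert[of "form L" "{form L'}"] zeros_form_member assms by simp
  moreover have "form {} = infinity_form" by (simp add: form_def)
  ultimately show ?thesis using infinity_form_in_span by metis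
qed

lemma infinity_in_span_triple:
  assumes "L \<in> insert H E" "L' \<in> insert H E" "L \<inter> L' \<inter> H = {}"
  shows "form {} \<in> vec.span {form L, form L', form H}"
proof -
  have "zeros {form L, form L', form H} = {}"
    using zeros_insert[of "form L" "{form L', form H}"] zeros_insert[of "form L'" "{form H}"]
      zeros_form_member assms by auto
  moreover have "form {} = infinity_form" by (simp add: form_def)
  ultimately show ?thesis using infinity_form_in_span by metis
qed

lemma line_eq_containing:
  assumes "K \<in> E" "L \<in> E" "K \<inter> L \<noteq> {}"
  shows "P.line K L = {M \<in> A. K \<inter> L \<subseteq> M}"
  using assms in_span_pair_iff[of _ K L] unfolding P.line_def by auto

lemma infinity_in_line: "K \<in> E \<Longrightarrow> L \<in> E \<Longrightarrow> K \<inter> L = {} \<Longrightarrow> {} \<in> P.line K L"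
  using infinity_in_span_pair[of K L] unfolding P.line_def by auto

text \<open>A line misses infinity if and only if two of its hyperplanes meet; it then consists of
  all members through a flat of codimension 2.\<close>

lemma lines_avoiding_infinity:
  "{B \<in> P.lines. {} \<notin> B} = (\<lambda>X. {M \<in> A. X \<subseteq> M}) ` pair_meets A"
proof (intro equalityI subsetI)
  fix B assume "B \<in> {B \<in> P.lines. {} \<notin> B}"
  then obtain K L where KL: "K \<in> E" "L \<in> E" "K \<noteq> L" "B = P.line K L" "{} \<notin> B"
    by (auto simp: P.lines_def)
  then have ne: "K \<inter> L \<noteq> {}" using infinity_in_line by blast
  then have "K \<in> A" "L \<in> A" using KL by auto
  then have "K \<inter> L \<in> pair_meets A" using KL(3) ne unfolding pair_meets_def by blast
  then show "B \<in> (\<lambda>X. {M \<in> A. X \<subseteq> M}) ` pair_meets A"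
    using line_eq_containing[OF KL(1,2) ne] KL(4) by blast
next
  fix B assume "B \<in> (\<lambda>X. {M \<in> A. X \<subseteq> M}) ` pair_meets A"
  then obtain K L where KL: "K \<in> A" "L \<in> A" "K \<noteq> L" "K \<inter> L \<noteq> {}" "B = {M \<in> A. K \<inter> L \<subseteq> M}"
    by (auto simp: pair_meets_def)
  then have "B = P.line K L" using line_eq_containing[of K L] by simp
  moreover have "{} \<notin> A" using hyperplanes aff_hyperplane_zeros(2) by blast
  ultimately show "B \<in> {B \<in> P.lines. {} \<notin> B}"
    using KL unfolding P.lines_def by blast
qed

lemma inj_on_containing: "inj_on (\<lambda>X. {M \<in> A. X \<subseteq> M}) (pair_meets A)"
proof (rule inj_on_inverseI)
  fix X assume "X \<in> pair_meets A"
  then show "\<Inter>{M \<in> A. X \<subseteq> M} = X" by (auto simp: pair_meets_def)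
qed

text \<open>The lines through infinity are the parallel classes with infinity added and contribute
  \<open>card A\<close> in all; the other lines give the second Betti number.\<close>

lemma sum_lines:
  "(\<Sum>B\<in>P.lines. card B - 1) = card A + (\<Sum>X\<in>pair_meets A. card {M \<in> A. X \<subseteq> M} - 1)"
proof -
  have "{} \<notin> A" using hyperplanes aff_hyperplane_zeros(2) by blast
  then have "card E - 1 = card A" using finite_A by simp
  moreover have "(\<Sum>B\<in>P.lines. card B - 1)
      = (\<Sum>B\<in>{B \<in> P.lines. {} \<in> B}. card B - 1) + (\<Sum>B\<in>{B \<in> P.lines. {} \<notin> B}. card B - 1)"
    by (subst sum.union_disjoint[symmetric]) (auto intro: sum.cong)
  moreover have "(\<Sum>B\<in>{B \<in> P.lines. {} \<notin> B}. card B - 1) = (\<Sum>X\<in>pair_meets A. card {M \<in> A. X \<subseteq> M} - 1)"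
    unfolding lines_avoiding_infinity by (simp add: sum.reindex[OF inj_on_containing])
  ultimately show ?thesis using P.sum_lines_through[of "{}"] by simp
qed

abbreviation "R \<equiv> restriction A H"
abbreviation "over Z \<equiv> {M \<in> A. Z \<subseteq> M}"

lemma restriction_eq: "R = {H \<inter> K |K. K \<in> A \<and> H \<inter> K \<noteq> {}}"
  using H_notin by (auto simp: restriction_def)

lemma cls_meeting:
  assumes "K \<in> A" "H \<inter> K \<noteq> {}"
  shows "P.cls K = over (H \<inter> K)"
  using assms in_span_pair_iff[of _ K H] unfolding P.cls_def by (auto simp: Int_commute)

text \<open>If \<open>K\<close> is parallel to \<open>H\<close>, the span of their forms contains
  the constant form, so \<open>K\<close> lies in the fibre of infinity.\<close>

lemma cls_parallel:
  assumes "K \<in> E" "H \<inter> K = {}"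
  shows "P.cls K = P.cls {}"
proof -
  have "{} \<in> P.cls K"
    using infinity_in_span_pair[of K H] assms unfolding P.cls_def by (auto simp: Int_commute)
  then show ?thesis using P.in_cls_iff[of K "{}"] assms by simp
qed

lemma inj_on_over: "inj_on over R"
proof (rule inj_on_inverseI)
  fix Z assume "Z \<in> R"
  then show "H \<inter> \<Inter>(over Z) = Z" by (auto simp: restriction_eq)
qed

lemma cls_infinity_notin: "P.cls {} \<notin> over ` R"
proof
  assume "P.cls {} \<in> over ` R"
  then obtain Z where "Z \<in> R" "{} \<in> over Z" using P.in_cls_self[of "{}"] by auto
  then show False by (auto simp: restriction_eq)
qed

lemma classes_eq: "P.classes = insert (P.cls {}) (over ` R)"
proof (intro equalityI subsetI)
  fix Z assume "Z \<in> P.classes"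
  then obtain K where K: "K \<in> E" "Z = P.cls K" by (auto simp: P.classes_def)
  show "Z \<in> insert (P.cls {}) (over ` R)"
  proof (cases "H \<inter> K = {}")
    case True
    then show ?thesis using cls_parallel[OF K(1)] K(2) by simp
  next
    case False
    then have "K \<in> A" "H \<inter> K \<in> R" using K(1) by (auto simp: restriction_eq)
    then show ?thesis using cls_meeting[OF _ False] K(2) by blast
  qed
next
  fix Z assume "Z \<in> insert (P.cls {}) (over ` R)"
  then consider "Z = P.cls {}" | K where "K \<in> A" "H \<inter> K \<noteq> {}" "Z = over (H \<inter> K)"
    by (auto simp: restriction_eq)
  then show "Z \<in> P.classes"
  proof cases
    case 2
    then have "Z = P.cls K" using cls_meeting by simp
    then show ?thesis using 2 by (simp add: P.classes_def)
  qed (simp add: P.classes_def)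
qed

lemma finite_R: "finite R"
proof -
  have "R \<subseteq> (\<lambda>K. H \<inter> K) ` A" by (auto simp: restriction_eq)
  then show ?thesis using finite_A by (rule finite_subset[OF _ finite_imageI])
qed

lemma card_classes: "card P.classes = card R + 1"
  using cls_infinity_notin finite_R by (simp add: classes_eq card_image[OF inj_on_over])

text \<open>Projecting from the point of \<open>H\<close> amounts to restricting to
  \<open>H\<close>: fibres other than that of infinity are members of \<open>R\<close>, and planes
  missing infinity are codimension-2 flats of \<open>R\<close>.\<close>

lemma planes_avoiding_infinity:
  "{Y \<in> P.planes. P.cls {} \<notin> Y} = (\<lambda>X. over ` {Z \<in> R. X \<subseteq> Z}) ` pair_meets R"
proof -
  have plane: "P.cls ` P.plane K L = over ` {Z \<in> R. K \<inter> L \<inter> H \<subseteq> Z}"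
    if KL: "K \<in> A" "L \<in> A" "K \<inter> L \<inter> H \<noteq> {}" for K L
  proof -
    have p: "P.plane K L = over (K \<inter> L \<inter> H)"
      using KL in_span_triple_iff[of _ K L] unfolding P.plane_def by auto
    have "P.cls M = over (H \<inter> M)" if "M \<in> over (K \<inter> L \<inter> H)" for M
      using that KL(3) by (intro cls_meeting) auto
    then have "P.cls ` P.plane K L = over ` (\<lambda>M. H \<inter> M) ` over (K \<inter> L \<inter> H)"
      unfolding p by (simp only: image_image cong: image_cong)
    also have "(\<lambda>M. H \<inter> M) ` over (K \<inter> L \<inter> H) = {Z \<in> R. K \<inter> L \<inter> H \<subseteq> Z}"
      using KL(3) by (auto simp: restriction_eq)
    finally show ?thesis .
  qed
  show ?thesis
  proof (intro equalityI subsetI)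
    fix Y assume "Y \<in> {Y \<in> P.planes. P.cls {} \<notin> Y}"
    then obtain K L where KL: "K \<in> E" "L \<in> E" "P.cls K \<noteq> P.cls L" "Y = P.cls ` P.plane K L" "P.cls {} \<notin> Y"
      by (auto simp: P.planes_def)
    have ne: "K \<inter> L \<inter> H \<noteq> {}"
    proof
      assume "K \<inter> L \<inter> H = {}"
      then have "{} \<in> P.plane K L" using infinity_in_span_triple[of K L] KL unfolding P.plane_def by auto
      with KL show False by blast
    qed
    then have A: "K \<in> A" "L \<in> A" using KL by auto
    have "H \<inter> K \<noteq> {}" "H \<inter> L \<noteq> {}" using ne by auto
    then have "H \<inter> K \<noteq> H \<inter> L"
      using cls_meeting[OF A(1)] cls_meeting[OF A(2)] KL(3) by metis
    moreover have "H \<inter> K \<in> R" "H \<inter> L \<in> R" using A ne by (auto simp: restriction_eq)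
    moreover have "(H \<inter> K) \<inter> (H \<inter> L) = K \<inter> L \<inter> H" by blast
    ultimately have "K \<inter> L \<inter> H \<in> pair_meets R" using ne unfolding pair_meets_def by blast
    then show "Y \<in> (\<lambda>X. over ` {Z \<in> R. X \<subseteq> Z}) ` pair_meets R" using plane[OF A ne] KL(4) by blast
  next
    fix Y assume "Y \<in> (\<lambda>X. over ` {Z \<in> R. X \<subseteq> Z}) ` pair_meets R"
    then obtain K L where KL: "K \<in> A" "L \<in> A" "H \<inter> K \<noteq> H \<inter> L" "(H \<inter> K) \<inter> (H \<inter> L) \<noteq> {}"
      "Y = over ` {Z \<in> R. (H \<inter> K) \<inter> (H \<inter> L) \<subseteq> Z}"
      unfolding pair_meets_def by (auto simp: restriction_eq)
    have eq: "(H \<inter> K) \<inter> (H \<inter> L) = K \<inter> L \<inter> H" by blast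
    have Y: "Y = P.cls ` P.plane K L" using plane[of K L] KL unfolding eq by simp
    have "H \<inter> K \<in> R" "H \<inter> L \<in> R" using KL by (auto simp: restriction_eq)
    then have "over (H \<inter> K) \<noteq> over (H \<inter> L)"
      using KL(3) inj_onD[OF inj_on_over, of "H \<inter> K" "H \<inter> L"] by blast
    moreover have "H \<inter> K \<noteq> {}" "H \<inter> L \<noteq> {}" using KL(4) by auto
    ultimately have "P.cls K \<noteq> P.cls L"
      using cls_meeting[OF KL(1)] cls_meeting[OF KL(2)] by simp
    then have "Y \<in> P.planes" using Y KL unfolding P.planes_def by blast
    moreover have "P.cls {} \<notin> Y" using cls_infinity_notin KL(5) by blast
    ultimately show "Y \<in> {Y \<in> P.planes. P.cls {} \<notin> Y}" by blast
  qed
qed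

lemma sum_planes:
  "(\<Sum>Y\<in>P.planes. card Y - 1) = card R + (\<Sum>X\<in>pair_meets R. card {Z \<in> R. X \<subseteq> Z} - 1)"
proof -
  have inj: "inj_on (\<lambda>X. over ` {Z \<in> R. X \<subseteq> Z}) (pair_meets R)"
  proof (rule inj_onI)
    fix X X' assume X: "X \<in> pair_meets R" "X' \<in> pair_meets R"
      and eq: "over ` {Z \<in> R. X \<subseteq> Z} = over ` {Z \<in> R. X' \<subseteq> Z}"
    have "{Z \<in> R. X \<subseteq> Z} = {Z \<in> R. X' \<subseteq> Z}"
      using eq by (subst (asm) inj_on_image_eq_iff[OF inj_on_over]) auto
    moreover have "\<Inter>{Z \<in> R. X \<subseteq> Z} = X" if "X \<in> pair_meets R" for X
      using that unfolding pair_meets_def by auto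
    ultimately show "X = X'" using X by metis
  qed
  have card: "card (over ` {Z \<in> R. X \<subseteq> Z}) = card {Z \<in> R. X \<subseteq> Z}" for X
    by (rule card_image) (rule inj_on_subset[OF inj_on_over], auto)
  have "P.cls {} \<in> P.classes" by (simp add: classes_eq)
  then have "(\<Sum>Y\<in>{Y \<in> P.planes. P.cls {} \<in> Y}. card Y - 1) = card R"
    using P.sum_planes_through card_classes by simp
  moreover have "(\<Sum>Y\<in>P.planes. card Y - 1)
      = (\<Sum>Y\<in>{Y \<in> P.planes. P.cls {} \<in> Y}. card Y - 1) + (\<Sum>Y\<in>{Y \<in> P.planes. P.cls {} \<notin> Y}. card Y - 1)"
    by (subst sum.union_disjoint[symmetric]) (auto intro: sum.cong)
  moreover have "(\<Sum>Y\<in>{Y \<in> P.planes. P.cls {} \<notin> Y}. card Y - 1) = (\<Sum>X\<in>pair_meets R. card {Z \<in> R. X \<subseteq> Z} - 1)"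
    unfolding planes_avoiding_infinity by (simp add: sum.reindex[OF inj] card)
  ultimately show ?thesis by simp
qed

lemma card_R_le: "card R \<le> card A"
proof -
  have "R \<subseteq> (\<lambda>K. H \<inter> K) ` A" by (auto simp: restriction_eq)
  then show ?thesis using card_mono[OF finite_imageI[OF finite_A]] card_image_le[OF finite_A] by (meson le_trans)
qed

theorem section_inequality:
  "(\<Sum>X\<in>pair_meets R. card {Z \<in> R. X \<subseteq> Z} - 1) + card R * (card A - card R)
     \<le> (\<Sum>X\<in>pair_meets A. card {M \<in> A. X \<subseteq> M} - 1)"
proof -
  have "{} \<notin> A" using hyperplanes aff_hyperplane_zeros(2) by blast
  then have "card E - card P.classes = card A - card R" using finite_A by (simp add: card_classes)
  then show ?thesis
    using P.central_inequality card_R_le unfolding sum_lines sum_planes card_classes by simp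
qed

end

section \<open>Coefficients of the characteristic polynomials and the final estimate\<close>

lemma coeff_sum_alternating_monom:
  fixes b :: "nat \<Rightarrow> int"
  assumes "j \<le> n"
  shows "coeff (\<Sum>i\<le>n. monom ((-1) ^ i * b i) (n - i)) (n - j) = (-1) ^ j * b j"
proof -
  have "coeff (\<Sum>i\<le>n. monom ((-1) ^ i * b i) (n - i)) (n - j) = (\<Sum>i\<le>n. if i = j then (-1) ^ i * b i else 0)"
    unfolding coeff_sum using assms by (intro sum.cong) auto
  then show ?thesis using assms by simp
qed

lemma hyperplanes_in_UNIV:
  assumes A: "aff_arrangement A"
  shows "hyperplanes_in UNIV A"
proof
  show "\<exists>S. UNIV = zeros S" by (rule exI[of _ "{}"]) simp
  fix K assume "K \<in> A"
  then have K: "aff_hyperplane K" using A by (simp add: aff_arrangement_def)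
  show "\<exists>v. K = UNIV \<inter> zeros {v}" using aff_hyperplane_zeros(1)[OF K] by auto
  show "K \<noteq> {}" "K \<noteq> UNIV" by (rule aff_hyperplane_zeros[OF K])+
qed (use A in \<open>auto simp: aff_arrangement_def\<close>)

lemma affine_dim_hyperplane:
  fixes H :: "('k::field ^ 'n) set"
  assumes "aff_hyperplane H"
  shows "affine_dim H + 1 = CARD('n)"
proof -
  obtain v where "zeros {v} = H" using aff_hyperplane_zeros(1)[OF assms] by blast
  then show ?thesis
    using affine_dim_cut[of "{}" v] aff_hyperplane_zeros(2,3)[OF assms] by (auto simp: affine_dim_UNIV)
qed

lemma hyperplanes_in_restriction:
  fixes H :: "('k::field ^ 'n) set"
  assumes "aff_arrangement A" "aff_hyperplane H"
  shows "hyperplanes_in H (restriction A H)"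
proof
  have hyp: "aff_hyperplane K" if "K \<in> A" for K using assms(1) that by (auto simp: aff_arrangement_def)
  show "\<exists>S. H = zeros S" using aff_hyperplane_zeros(1)[OF assms(2)] by blast
  have "restriction A H \<subseteq> (\<lambda>K. H \<inter> K) ` A" by (auto simp: restriction_def)
  then show "finite (restriction A H)"
    by (rule finite_subset) (use assms(1) in \<open>simp add: aff_arrangement_def\<close>)
  fix Z assume "Z \<in> restriction A H"
  then obtain K where K: "K \<in> A" "K \<noteq> H" "Z = H \<inter> K" "Z \<noteq> {}" by (auto simp: restriction_def)
  show "\<exists>v. Z = H \<inter> zeros {v}" using aff_hyperplane_zeros(1)[OF hyp[OF K(1)]] K(3) by blast
  show "Z \<noteq> {}" by (rule K(4))
  show "Z \<noteq> H"
  proof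
    assume "Z = H"
    then have "H \<subset> K" using K by blast
    \<comment> \<open>In this two-element arrangement both \<open>H\<close> and \<open>K\<close> are
      flats, so a proper inclusion would contradict their equal dimensions.\<close>
    interpret HK: hyperplanes_in UNIV "{H, K}"
      by (rule hyperplanes_in_UNIV) (use assms(2) hyp K in \<open>auto simp: aff_arrangement_def\<close>)
    have "affine_dim H < affine_dim K" using HK.flat_psubset_dim[OF HK.hyp_flat HK.hyp_flat \<open>H \<subset> K\<close>] by simp
    then show False using affine_dim_hyperplane[OF assms(2)] affine_dim_hyperplane[OF hyp[OF K(1)]] by simp
  qed
qed (use aff_hyperplane_zeros(2)[OF assms(2)] in auto)

lemma finite_pair_meets: "finite A \<Longrightarrow> finite (pair_meets A)"
  by (rule finite_subset[of _ "(\<lambda>(K, L). K \<inter> L) ` (A \<times> A)"]) (auto simp: pair_meets_def)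

lemma sum_pair_meets_int:
  assumes "finite A"
  shows "(\<Sum>X\<in>pair_meets A. int (card {K \<in> A. X \<subseteq> K}) - 1) = int (\<Sum>X\<in>pair_meets A. card {K \<in> A. X \<subseteq> K} - 1)"
proof -
  have "card {K \<in> A. X \<subseteq> K} \<noteq> 0" if "X \<in> pair_meets A" for X
    using that assms by (auto simp: pair_meets_def)
  then show ?thesis unfolding of_nat_sum by (intro sum.cong refl) (simp add: of_nat_diff Suc_leI)
qed

lemma b2_inequality:
  fixes A :: "('k::field ^ 'n) set set" and b c :: "nat \<Rightarrow> int"
  assumes n: "CARD('n) \<ge> 3" and A: "aff_arrangement A" and H: "aff_hyperplane H"
    and b: "char_polynomial UNIV A = (\<Sum>i\<le>CARD('n). monom ((-1) ^ i * b i) (CARD('n) - i))"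
    and c: "char_polynomial H (restriction A H)
          = (\<Sum>i\<le>CARD('n) - 1. monom ((-1) ^ i * c i) (CARD('n) - 1 - i))"
  shows "b 2 \<ge> c 2 + (b 1 - int (card (restriction A H)) - 1) * int (card (restriction A H))"
proof -
  interpret U: hyperplanes_in UNIV A by (rule hyperplanes_in_UNIV[OF A])
  interpret V: hyperplanes_in H "restriction A H" by (rule hyperplanes_in_restriction[OF A H])
  let ?R = "restriction A H"
  define S where "S B = (\<Sum>X\<in>pair_meets B. card {K \<in> B. X \<subseteq> K} - 1)" for B :: "('k ^ 'n) set set"
  have "coeff (char_polynomial UNIV A) (CARD('n) - 1) = - b 1"
    using coeff_sum_alternating_monom[of 1 "CARD('n)" b] n unfolding b by simp
  then have b1: "b 1 = int (card A)"
    using U.coeff_codim1[of "CARD('n) - 1"] n by (simp add: affine_dim_UNIV)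
  have "coeff (char_polynomial UNIV A) (CARD('n) - 2) = b 2"
    using coeff_sum_alternating_monom[of 2 "CARD('n)" b] n unfolding b by simp
  then have b2: "b 2 = int (S A)"
    using U.coeff_codim2[of "CARD('n) - 2"] n sum_pair_meets_int[OF U.finite_A]
    by (simp add: affine_dim_UNIV S_def)
  have "coeff (char_polynomial H ?R) (CARD('n) - 1 - 2) = c 2"
    using coeff_sum_alternating_monom[of 2 "CARD('n) - 1" c] n unfolding c by simp
  then have c2: "c 2 = int (S ?R)"
    using V.coeff_codim2[of "CARD('n) - 1 - 2"] n affine_dim_hyperplane[OF H] sum_pair_meets_int[OF V.finite_A]
    by (simp add: S_def)
  \<comment> \<open>Deleting \<open>H\<close> leaves the restriction unchanged and can only decrease
    the sum over codimension-2 flats, so the estimate passes back to \<open>A\<close>.\<close>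
  interpret sec: hyperplane_section H "A - {H}"
    by standard (use H A in \<open>auto simp: aff_arrangement_def\<close>)
  have R: "restriction (A - {H}) H = ?R" by (auto simp: restriction_def)
  have ineq: "S ?R + card ?R * (card (A - {H}) - card ?R) \<le> S (A - {H})"
    using sec.section_inequality unfolding R S_def .
  have "S (A - {H}) \<le> (\<Sum>X\<in>pair_meets (A - {H}). card {K \<in> A. X \<subseteq> K} - 1)"
    unfolding S_def using U.finite_A by (intro sum_mono diff_le_mono card_mono) auto
  also have "\<dots> \<le> S A"
    unfolding S_def using finite_pair_meets[OF U.finite_A] by (intro sum_mono2) (auto simp: pair_meets_def)
  finally have "S ?R + card ?R * (card (A - {H}) - card ?R) \<le> S A" using ineq by linarith
  then have main: "int (S ?R) + int (card ?R) * (int (card (A - {H})) - int (card ?R)) \<le> int (S A)"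
    using sec.card_R_le unfolding R by (metis of_nat_add of_nat_diff of_nat_le_iff of_nat_mult)
  \<comment> \<open>At most one hyperplane has been deleted; this is the -1 in the bound.\<close>
  have "int (card A) - 1 \<le> int (card (A - {H}))"
    using U.finite_A by (cases "H \<in> A") (auto simp: card_Diff_singleton)
  then have "(int (card A) - int (card ?R) - 1) * int (card ?R) \<le> int (card ?R) * (int (card (A - {H})) - int (card ?R))"
    by (subst mult.commute, intro mult_left_mono) auto
  with main show ?thesis unfolding b1 b2 c2 by linarith
qed

theorem theorem7p1:
  fixes A :: "('k::field ^ 'n) set set"
    and b :: "nat \<Rightarrow> int"
  assumes "CARD('n) \<ge> 3"
    and "aff_arrangement A"
    and "char_polynomial UNIV A = (\<Sum>i\<le>CARD('n). monom ((-1) ^ i * b i) (CARD('n) - i))"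
  shows
    "(\<forall>H (c :: nat \<Rightarrow> int). aff_hyperplane H \<longrightarrow>
        char_polynomial H (restriction A H)
          = (\<Sum>i\<le>CARD('n) - 1. monom ((-1) ^ i * c i) (CARD('n) - 1 - i)) \<longrightarrow>
        b 2 \<ge> c 2 + (b 1 - int (card (restriction A H)) - 1) * int (card (restriction A H)))
     \<and>
     (\<forall>c :: nat \<Rightarrow> int. (b 1 - 1)\<^sup>2 - 4 * b 2 + 4 * c 2 \<ge> 0 \<longrightarrow>
        \<not> (\<exists>L. aff_hyperplane L \<and>
            char_polynomial L (restriction A L)
              = (\<Sum>i\<le>CARD('n) - 1. monom ((-1) ^ i * c i) (CARD('n) - 1 - i)) \<and>
            (real_of_int (b 1) - 1
                - sqrt (real_of_int ((b 1 - 1)\<^sup>2 - 4 * b 2 + 4 * c 2))) / 2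
              < real (card (restriction A L)) \<and>
            real (card (restriction A L))
              < (real_of_int (b 1) - 1
                + sqrt (real_of_int ((b 1 - 1)\<^sup>2 - 4 * b 2 + 4 * c 2))) / 2))"
proof (intro conjI allI impI notI)
  show "b 2 \<ge> c 2 + (b 1 - int (card (restriction A H)) - 1) * int (card (restriction A H))"
    if "aff_hyperplane H" "char_polynomial H (restriction A H)
          = (\<Sum>i\<le>CARD('n) - 1. monom ((-1) ^ i * c i) (CARD('n) - 1 - i))" for H and c :: "nat \<Rightarrow> int"
    using b2_inequality[OF assms(1,2) that(1) assms(3) that(2)] .
next
  fix c :: "nat \<Rightarrow> int"
  let ?D = "(b 1 - 1)\<^sup>2 - 4 * b 2 + 4 * c 2"
  assume D: "?D \<ge> 0"
  assume "\<exists>L. aff_hyperplane L \<and>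
            char_polynomial L (restriction A L)
              = (\<Sum>i\<le>CARD('n) - 1. monom ((-1) ^ i * c i) (CARD('n) - 1 - i)) \<and>
            (real_of_int (b 1) - 1 - sqrt (real_of_int ?D)) / 2 < real (card (restriction A L)) \<and>
            real (card (restriction A L)) < (real_of_int (b 1) - 1 + sqrt (real_of_int ?D)) / 2"
  then obtain L where L: "aff_hyperplane L" "char_polynomial L (restriction A L)
              = (\<Sum>i\<le>CARD('n) - 1. monom ((-1) ^ i * c i) (CARD('n) - 1 - i))"
    and lower: "(real_of_int (b 1) - 1 - sqrt (real_of_int ?D)) / 2 < real (card (restriction A L))"
    and upper: "real (card (restriction A L)) < (real_of_int (b 1) - 1 + sqrt (real_of_int ?D)) / 2"
    by blast
  define h where "h = int (card (restriction A L))"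
  have ineq: "b 2 \<ge> c 2 + (b 1 - h - 1) * h"
    using b2_inequality[OF assms(1,2) L(1) assms(3) L(2)] by (simp add: h_def)
  \<comment> \<open>The two strict bounds confine \<open>h\<close> around the centre
    \<open>(b 1 - 1) / 2\<close>. Squaring contradicts \<open>ineq\<close>, which says that the
    square of \<open>2 * h - (b 1 - 1)\<close> is at least \<open>?D\<close>.\<close>
  have "\<bar>real_of_int (2 * h - (b 1 - 1))\<bar> < sqrt (real_of_int ?D)"
    using lower upper by (simp add: h_def abs_less_iff field_simps)
  then have "\<bar>real_of_int (2 * h - (b 1 - 1))\<bar>\<^sup>2 < (sqrt (real_of_int ?D))\<^sup>2"
    by (intro power_strict_mono) auto
  moreover have "real_of_int ?D \<ge> 0" using D by (simp only: of_int_0_le_iff)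
  ultimately have "real_of_int ((2 * h - (b 1 - 1))\<^sup>2) < real_of_int ?D"
    by (simp only: power2_abs real_sqrt_pow2 of_int_power)
  then have "(2 * h - (b 1 - 1))\<^sup>2 < ?D" by linarith
  with ineq show False by (simp add: power2_eq_square algebra_simps)
qed

end
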